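(* Let $p>q$ be prime numbers with $p\equiv1\pmod q$, let $g$ be an integer whose multiplicative order modulo $p$ is $q$, and let $G=\{\sigma^i\tau^j\mid 0\le i\le p-1,\ 0\le j\le q-1\}$ be the cyclic group of order $pq$ with $\sigma$ of order $p$, $\tau$ of order $q$ and $\tau\sigma\tau^{-1}=\sigma$. For $1\le t\le q-1$ let $N_t=\varphi_t^{-1}N\varphi_t$ and $N_t^{opp}=\varphi_t^{-1}N^{opp}\varphi_t$, where $\varphi_t\in\mathrm{Aut}(G)$ is given by $\varphi_t(\sigma)=\sigma^t$, $\varphi_t(\tau)=\tau^t$, and $N=\langle\eta,\pi\rangle$, $N^{opp}=\langle\eta',\pi'\rangle$ are the subgroups of $\mathrm{Perm}(G)$ generated by the permutations $$\eta(\sigma^k\tau^\ell)=\sigma^{k+1}\tau^\ell,\quad \pi(\sigma^k\tau^\ell)=\sigma^{kg}\tau^{\ell+1},\quad \eta'(\sigma^k\tau^\ell)=\sigma^{k+g^\ell}\tau^\ell,\quad \pi'(\sigma^k\tau^\ell)=\sigma^k\tau^{\ell+1}.$$ Then the subgroups $N_t$ ($1\le t\le q-1$) are mutually $G$-isomorphic. The subgroups $N_t^{opp}$ ($1\le t\le q-1$) are pairwise non $G$-isomorphic, and none of them is $G$-isomorphic to any of the subgroups $N_t$.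
   Context: $\mathrm{Perm}(G)$ is the group of permutations of $G$ and $\lambda(\sigma)[\tau]=\sigma\tau$. $G$ acts on $\mathrm{Perm}(G)$ by ${}^{x}\pi=\lambda(x)\pi\lambda(x)^{-1}$. A subgroup of $\mathrm{Perm}(G)$ is regular if it acts transitively on $G$ with trivial stabilizers, and $G$-stable if it is preserved by this action. Two regular $G$-stable subgroups $N,M$ are $G$-isomorphic if there is a group isomorphism $\theta:N\to M$ with $\theta({}^{x}\nu)={}^{x}\theta(\nu)$ for all $\nu\in N$, $x\in G$. The subgroups $N_t$ and $N_t^{opp}$ are regular, $G$-stable and isomorphic to the nonabelian (metacyclic) group of order $pq$. Explicitly, $N_t=\langle\eta,\pi_t\rangle$ with $\pi_t(\sigma^k\tau^\ell)=\sigma^{kg}\tau^{\ell+t^{-1}}$ and $N_t^{opp}=\langle\eta'_t,\pi'\rangle$ with $\eta'_t(\sigma^k\tau^\ell)=\sigma^{k+t^{-1}g^{t\ell}}\tau^\ell$, where $t^{-1}$ in an exponent of $\sigma$ (resp. $\tau$) is an inverse of $t$ modulo $p$ (resp. $q$). *)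

theory Defs
  imports "HOL-Number_Theory.Number_Theory" "HOL-Algebra.Bij" "HOL-Algebra.Elementary_Groups"
begin

text \<open>
  Permutations of the underlying set of a group \<open>G\<close> form the library group
  \<open>BijGroup (carrier G)\<close>, whose elements are extensional functions and whose product
  is composition (the right factor is applied first).
\<close>

abbreviation Perm :: "('a, 'b) monoid_scheme \<Rightarrow> ('a \<Rightarrow> 'a) monoid" where
  "Perm G \<equiv> BijGroup (carrier G)"

definition left_reg :: "('a, 'b) monoid_scheme \<Rightarrow> 'a \<Rightarrow> 'a \<Rightarrow> 'a" where
  "left_reg G x = (\<lambda>y \<in> carrier G. x \<otimes>\<^bsub>G\<^esub> y)"

definition perm_act :: "('a, 'b) monoid_scheme \<Rightarrow> 'a \<Rightarrow> ('a \<Rightarrow> 'a) \<Rightarrow> ('a \<Rightarrow> 'a)" where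
  "perm_act G x \<nu> =
     left_reg G x \<otimes>\<^bsub>Perm G\<^esub> \<nu> \<otimes>\<^bsub>Perm G\<^esub> inv\<^bsub>Perm G\<^esub> (left_reg G x)"

definition regular_subgroup :: "('a, 'b) monoid_scheme \<Rightarrow> ('a \<Rightarrow> 'a) set \<Rightarrow> bool" where
  "regular_subgroup G N \<longleftrightarrow>
     subgroup N (Perm G) \<and>
     (\<forall>x \<in> carrier G. \<forall>y \<in> carrier G. \<exists>\<nu> \<in> N. \<nu> x = y) \<and>
     (\<forall>x \<in> carrier G. \<forall>\<nu> \<in> N. \<nu> x = x \<longrightarrow> \<nu> = \<one>\<^bsub>Perm G\<^esub>)"

definition G_stable :: "('a, 'b) monoid_scheme \<Rightarrow> ('a \<Rightarrow> 'a) set \<Rightarrow> bool" where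
  "G_stable G N \<longleftrightarrow> (\<forall>x \<in> carrier G. \<forall>\<nu> \<in> N. perm_act G x \<nu> \<in> N)"

text \<open>
  The following relation is meant for regular \<open>G\<close>-stable subgroups \<open>N\<close> and \<open>M\<close>. This is not
  part of the definition; for the subgroups considered here it is established by the lemmas
  \<open>conj_N_regular_stable\<close> and \<open>conj_Nopp_regular_stable\<close> below.
\<close>

definition G_isomorphic ::
  "('a, 'b) monoid_scheme \<Rightarrow> ('a \<Rightarrow> 'a) set \<Rightarrow> ('a \<Rightarrow> 'a) set \<Rightarrow> bool" where
  "G_isomorphic G N M \<longleftrightarrow>
     (\<exists>\<theta> \<in> iso (Perm G\<lparr>carrier := N\<rparr>) (Perm G\<lparr>carrier := M\<rparr>).
        \<forall>x \<in> carrier G. \<forall>\<nu> \<in> N. \<theta> (perm_act G x \<nu>) = perm_act G x (\<theta> \<nu>))"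

definition conj_by ::
  "('a, 'b) monoid_scheme \<Rightarrow> ('a \<Rightarrow> 'a) \<Rightarrow> ('a \<Rightarrow> 'a) set \<Rightarrow> ('a \<Rightarrow> 'a) set" where
  "conj_by G \<phi> N = (\<lambda>\<nu>. inv\<^bsub>Perm G\<^esub> \<phi> \<otimes>\<^bsub>Perm G\<^esub> \<nu> \<otimes>\<^bsub>Perm G\<^esub> \<phi>) ` N"


lemma Perm_mult_apply:
  assumes "f \<in> carrier (Perm G)" "h \<in> carrier (Perm G)" "x \<in> carrier G"
  shows "(f \<otimes>\<^bsub>Perm G\<^esub> h) x = f (h x)"
  using assms by (simp add: BijGroup_def compose_eq)

lemma Perm_one_apply: "x \<in> carrier G \<Longrightarrow> \<one>\<^bsub>Perm G\<^esub> x = x"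
  by (simp add: BijGroup_def)

lemma Perm_closed_apply: "f \<in> carrier (Perm G) \<Longrightarrow> x \<in> carrier G \<Longrightarrow> f x \<in> carrier G"
  using Bij_imp_funcset by (force simp: BijGroup_def)

lemma Perm_inv_apply:
  assumes "f \<in> carrier (Perm G)" "y \<in> carrier G" "f y = x"
  shows "(inv\<^bsub>Perm G\<^esub> f) x = y"
proof -
  interpret P: group "Perm G" by (rule group_BijGroup)
  have "(inv\<^bsub>Perm G\<^esub> f) (f y) = (inv\<^bsub>Perm G\<^esub> f \<otimes>\<^bsub>Perm G\<^esub> f) y"
    by (rule Perm_mult_apply[symmetric]) (use assms in auto)
  then show ?thesis using assms by (simp add: Perm_one_apply)
qed

lemma Perm_eqI:
  assumes "f \<in> carrier (Perm G)" "h \<in> carrier (Perm G)" "\<And>x. x \<in> carrier G \<Longrightarrow> f x = h x"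
  shows "f = h"
  using assms by (auto simp: BijGroup_def Bij_def intro!: extensionalityI)

context group
begin

lemma left_reg_closed: 
  assumes "x \<in> carrier G" shows "left_reg G x \<in> carrier (Perm G)"
proof -
  have "bij_betw (left_reg G x) (carrier G) (carrier G)"
    by (rule bij_betwI[where g = "\<lambda>y. inv x \<otimes> y"])
       (use assms in \<open>auto simp: left_reg_def m_assoc[symmetric]\<close>)
  then show ?thesis by (auto simp: left_reg_def BijGroup_def Bij_def)
qed

lemma perm_act_closed:
  assumes "x \<in> carrier G" "f \<in> carrier (Perm G)"
  shows "perm_act G x f \<in> carrier (Perm G)"
proof -
  interpret P: group "Perm G" by (rule group_BijGroup)
  show ?thesis using assms left_reg_closed by (auto simp: perm_act_def)
qed

lemma perm_act_apply:
  assumes "x \<in> carrier G" "f \<in> carrier (Perm G)" "y \<in> carrier G"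
  shows "perm_act G x f y = x \<otimes> f (inv x \<otimes> y)"
proof -
  interpret P: group "Perm G" by (rule group_BijGroup)
  note L = left_reg_closed[OF assms(1)]
  have "(inv\<^bsub>Perm G\<^esub> (left_reg G x)) y = inv x \<otimes> y"
    by (rule Perm_inv_apply[OF L]) (use assms in \<open>auto simp: left_reg_def m_assoc[symmetric]\<close>)
  then show ?thesis
    using assms L Perm_closed_apply[OF assms(2)]
    by (simp add: perm_act_def Perm_mult_apply) (simp add: left_reg_def)
qed

lemma conj_by_regular_stable:
  assumes f: "f \<in> auto G" and reg: "regular_subgroup G N" and st: "G_stable G N"
  shows "regular_subgroup G (conj_by G f N) \<and> G_stable G (conj_by G f N)"
proof -
  interpret P: group "Perm G" by (rule group_BijGroup)
  have fP: "f \<in> carrier (Perm G)" and fhom: "f \<in> hom G G"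
    using f by (auto simp: auto_def BijGroup_def)
  have NP: "N \<subseteq> carrier (Perm G)" and subN: "subgroup N (Perm G)"
    using reg by (auto simp: regular_subgroup_def dest: subgroup.subset)
  define c where "c \<nu> = inv\<^bsub>Perm G\<^esub> f \<otimes>\<^bsub>Perm G\<^esub> \<nu> \<otimes>\<^bsub>Perm G\<^esub> f" for \<nu>
  have cN: "conj_by G f N = c ` N" by (auto simp: conj_by_def c_def)
  have cc: "c \<nu> \<in> carrier (Perm G)" if "\<nu> \<in> carrier (Perm G)" for \<nu>
    using that fP by (simp add: c_def)
  have cap: "f (c \<nu> x) = \<nu> (f x)" if "\<nu> \<in> carrier (Perm G)" "x \<in> carrier G" for \<nu> x
  proof -
    have "f \<otimes>\<^bsub>Perm G\<^esub> c \<nu> = \<nu> \<otimes>\<^bsub>Perm G\<^esub> f"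
      using that fP by (simp add: c_def P.m_assoc[symmetric])
    then show ?thesis using Perm_mult_apply[OF fP cc] Perm_mult_apply[OF _ fP] that by metis
  qed
  have finj: "x = y" if "f x = f y" "x \<in> carrier G" "y \<in> carrier G" for x y
    using that fP Perm_inv_apply by metis
  have fsurj: "\<exists>y \<in> carrier G. f y = x" if "x \<in> carrier G" for x
  proof -
    have "bij_betw f (carrier G) (carrier G)" using fP by (auto simp: BijGroup_def Bij_def)
    then show ?thesis using that by (metis bij_betw_def imageE)
  qed
  have f_inv: "f \<otimes>\<^bsub>Perm G\<^esub> (inv\<^bsub>Perm G\<^esub> f \<otimes>\<^bsub>Perm G\<^esub> \<mu>) = \<mu>"
    if "\<mu> \<in> carrier (Perm G)" for \<mu>
    using that fP by (simp add: P.m_assoc[symmetric])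
  have chom: "c \<in> hom (Perm G) (Perm G)"
    by (rule homI) (use fP in \<open>auto simp: c_def P.m_assoc f_inv\<close>)
  have sub: "subgroup (c ` N) (Perm G)"
    using chom subN group_BijGroup
    by (metis group_hom.intro group_hom_axioms.intro group_hom.subgroup_img_is_subgroup)
  have "\<exists>\<mu> \<in> c ` N. \<mu> x = y" if x: "x \<in> carrier G" and y: "y \<in> carrier G" for x y
  proof -
    have fx: "f x \<in> carrier G" and fy: "f y \<in> carrier G" using Perm_closed_apply[OF fP] x y by auto
    obtain \<nu> where \<nu>: "\<nu> \<in> N" "\<nu> (f x) = f y"
      using reg fx fy unfolding regular_subgroup_def by metis
    then have "f (c \<nu> x) = f y" using cap x NP by auto
    then have "c \<nu> x = y" using finj y x Perm_closed_apply[OF cc] \<nu> NP by (metis subsetD)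
    then show ?thesis using \<nu> by auto
  qed
  moreover have "c \<nu> = \<one>\<^bsub>Perm G\<^esub>" if "x \<in> carrier G" "\<nu> \<in> N" "c \<nu> x = x" for x \<nu>
  proof -
    have "\<nu> (f x) = f x" using cap[of \<nu> x] that NP by auto
    then have "\<nu> = \<one>\<^bsub>Perm G\<^esub>"
      using reg that Perm_closed_apply[OF fP] unfolding regular_subgroup_def by metis
    then show ?thesis using fP by (simp add: c_def)
  qed
  ultimately have R: "regular_subgroup G (c ` N)"
    using sub unfolding regular_subgroup_def by blast
  have "perm_act G x (c \<nu>) = c (perm_act G (f x) \<nu>)"
    if x: "x \<in> carrier G" and \<nu>: "\<nu> \<in> N" for x \<nu>
  proof (rule Perm_eqI)
    have \<nu>P: "\<nu> \<in> carrier (Perm G)" using NP \<nu> by auto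
    have fx: "f x \<in> carrier G" using Perm_closed_apply[OF fP] x .
    show "perm_act G x (c \<nu>) \<in> carrier (Perm G)"
      by (intro perm_act_closed x cc \<nu>P)
    show "c (perm_act G (f x) \<nu>) \<in> carrier (Perm G)"
      by (intro perm_act_closed fx cc \<nu>P)
    fix y assume y: "y \<in> carrier G"
    have z: "inv x \<otimes> y \<in> carrier G" using x y by simp
    have finv: "f (inv x) = inv (f x)"
      using fhom x by (metis group_hom.hom_inv group_hom.intro group_hom_axioms.intro is_group)
    have cz: "c \<nu> (inv x \<otimes> y) \<in> carrier G" using Perm_closed_apply[OF cc[OF \<nu>P] z] .
    have "f (perm_act G x (c \<nu>) y) = f x \<otimes> f (c \<nu> (inv x \<otimes> y))"
      using perm_act_apply[OF x cc[OF \<nu>P] y] hom_mult[OF fhom x cz] by simp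
    also have "\<dots> = f x \<otimes> \<nu> (inv (f x) \<otimes> f y)"
      using cap[OF \<nu>P z] hom_mult[OF fhom _ y, of "inv x"] finv x by simp
    also have "\<dots> = perm_act G (f x) \<nu> (f y)"
      using perm_act_apply[OF fx \<nu>P, of "f y"] Perm_closed_apply[OF fP y] by simp
    also have "\<dots> = f (c (perm_act G (f x) \<nu>) y)"
      using cap[OF perm_act_closed[OF fx \<nu>P] y] by simp
    finally show "perm_act G x (c \<nu>) y = c (perm_act G (f x) \<nu>) y"
      using finj Perm_closed_apply y perm_act_closed fx x cc \<nu>P by metis
  qed
  then have "G_stable G (c ` N)"
    using st Perm_closed_apply[OF fP] unfolding G_stable_def by auto
  with R show ?thesis unfolding cN by simp
qed

text \<open>
  If \<open>X\<close> sits inside a subgroup \<open>H\<close> with trivial stabilizers and \<open>X\<close> is transitive,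
  then \<open>X = H\<close> and \<open>X\<close> is regular.
\<close>

lemma regular_criterion:
  assumes X: "subgroup X (Perm G)" and H: "subgroup H (Perm G)" and "X \<subseteq> H"
    and tr: "\<And>x. x \<in> carrier G \<Longrightarrow> \<exists>\<nu> \<in> X. \<nu> \<one> = x"
    and free: "\<And>x \<nu>. x \<in> carrier G \<Longrightarrow> \<nu> \<in> H \<Longrightarrow> \<nu> x = x \<Longrightarrow> \<nu> = \<one>\<^bsub>Perm G\<^esub>"
  shows "X = H \<and> regular_subgroup G X"
proof -
  interpret P: group "Perm G" by (rule group_BijGroup)
  note XP = subgroup.subset[OF X] and HP = subgroup.subset[OF H]
  have "\<exists>\<nu> \<in> X. \<nu> x = y" if x: "x \<in> carrier G" and y: "y \<in> carrier G" for x y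
  proof -
    obtain a b where a: "a \<in> X" "a \<one> = x" and b: "b \<in> X" "b \<one> = y" using tr x y by metis
    have ai: "inv\<^bsub>Perm G\<^esub> a \<in> X" using a X by (simp add: subgroup.m_inv_closed)
    have "b \<otimes>\<^bsub>Perm G\<^esub> inv\<^bsub>Perm G\<^esub> a \<in> X" using ai b X by (simp add: subgroup.m_closed)
    moreover have "(b \<otimes>\<^bsub>Perm G\<^esub> inv\<^bsub>Perm G\<^esub> a) x = y"
      using Perm_mult_apply[of b G "inv\<^bsub>Perm G\<^esub> a" x] Perm_inv_apply[of a G \<one> x]
        a b x subsetD[OF XP a(1)] subsetD[OF XP b(1)] subsetD[OF XP ai] by simp
    ultimately show ?thesis by blast
  qed
  moreover have "H \<subseteq> X"
  proof
    fix h assume h: "h \<in> H"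
    then obtain a where a: "a \<in> X" "a \<one> = h \<one>" using tr Perm_closed_apply HP one_closed by (metis subsetD)
    have aH: "a \<in> H" and hP: "h \<in> carrier (Perm G)" and aP: "a \<in> carrier (Perm G)"
      using a \<open>X \<subseteq> H\<close> h HP by auto
    have "inv\<^bsub>Perm G\<^esub> a \<otimes>\<^bsub>Perm G\<^esub> h \<in> H"
      using aH h H by (simp add: subgroup.m_closed subgroup.m_inv_closed)
    moreover have "(inv\<^bsub>Perm G\<^esub> a \<otimes>\<^bsub>Perm G\<^esub> h) \<one> = \<one>"
      using Perm_mult_apply[of "inv\<^bsub>Perm G\<^esub> a" G h \<one>] Perm_inv_apply[of a G \<one> "h \<one>"] a aP hP by simp
    ultimately have "inv\<^bsub>Perm G\<^esub> a \<otimes>\<^bsub>Perm G\<^esub> h = \<one>\<^bsub>Perm G\<^esub>" using free by blast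
    then have "h = a" using aP hP by (metis P.inv_closed P.inv_equality P.inv_inv P.inv_comm)
    then show "h \<in> X" using a by simp
  qed
  ultimately show ?thesis using assms unfolding regular_subgroup_def by blast
qed

end

locale cyclic_pq = comm_group G for G :: "('a, 'b) monoid_scheme" (structure) +
  fixes p q :: nat and g :: int and \<sigma> \<tau> :: 'a
  assumes prime_p: "prime p" and prime_q: "prime q" and q_less_p: "q < p"
    and ord_g: "Pocklington.ord p (nat (g mod int p)) = q"
    and \<sigma>: "\<sigma> \<in> carrier G" "group.ord G \<sigma> = p"
    and \<tau>: "\<tau> \<in> carrier G" "group.ord G \<tau> = q"
    and carrier_eq: "carrier G = {\<sigma> [^] i \<otimes> \<tau> [^] j | (i :: nat) (j :: nat). i \<le> p - 1 \<and> j \<le> q - 1}"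
begin

definition E :: "int \<Rightarrow> int \<Rightarrow> 'a" where "E k l = \<sigma> [^] k \<otimes> \<tau> [^] l"

lemma E_closed [simp]: "E k l \<in> carrier G"
  using \<sigma> \<tau> by (simp add: E_def)

lemma E_mult: "E k l \<otimes> E k' l' = E (k + k') (l + l')"
  using \<sigma> \<tau> by (simp add: E_def int_pow_mult m_ac)

lemma E_0 [simp]: "E 0 0 = \<one>" by (simp add: E_def)

lemma E_inv: "inv (E k l) = E (- k) (- l)"
  by (rule inv_equality) (auto simp: E_mult)

lemma p0: "0 < p" and q0: "0 < q"
  using prime_p prime_q by (auto simp: prime_gt_0_nat)

lemma coprime_pq: "coprime (int p) (int q)"
  using prime_p prime_q q_less_p by (simp add: primes_coprime)

lemma \<sigma>_eq: "\<sigma> [^] (k :: int) = \<sigma> [^] (k' :: int) \<longleftrightarrow> [k = k'] (mod int p)"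
  using int_pow_eq[OF \<sigma>(1)] \<sigma>(2) by (metis cong_iff_dvd_diff cong_sym_eq)

lemma \<tau>_eq: "\<tau> [^] (k :: int) = \<tau> [^] (k' :: int) \<longleftrightarrow> [k = k'] (mod int q)"
  using int_pow_eq[OF \<tau>(1)] \<tau>(2) by (metis cong_iff_dvd_diff cong_sym_eq)

lemma E_cong: "[k = k'] (mod int p) \<Longrightarrow> [l = l'] (mod int q) \<Longrightarrow> E k l = E k' l'"
  unfolding E_def by (metis \<sigma>_eq \<tau>_eq)

lemma E_one:
  assumes "E k l = \<one>" shows "[k = 0] (mod int p)" "[l = 0] (mod int q)"
proof -
  have "\<sigma> [^] (k * int q) \<otimes> \<tau> [^] (l * int q) = E k l [^] (int q)"
    using \<sigma> \<tau> by (simp add: E_def int_pow_distrib int_pow_pow)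
  moreover have "\<tau> [^] (l * int q) = \<tau> [^] (0 :: int)" by (subst \<tau>_eq) (simp add: cong_0_iff)
  ultimately have "\<sigma> [^] (k * int q) = \<sigma> [^] (0 :: int)" using assms \<sigma> by simp
  then have "int p dvd k * int q" by (simp only: \<sigma>_eq cong_0_iff)
  then show 1: "[k = 0] (mod int p)" using coprime_pq by (simp add: cong_0_iff coprime_dvd_mult_left_iff)
  have "\<sigma> [^] k = \<sigma> [^] (0 :: int)" using 1 by (simp only: \<sigma>_eq)
  then have "\<tau> [^] l = \<tau> [^] (0 :: int)" using assms \<tau> by (simp add: E_def)
  then show "[l = 0] (mod int q)" by (simp only: \<tau>_eq)
qed

lemma E_eq_iff: "E k l = E k' l' \<longleftrightarrow> [k = k'] (mod int p) \<and> [l = l'] (mod int q)"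
proof
  assume "E k l = E k' l'"
  then have "E (k - k') (l - l') = \<one>"
    using E_mult[of k l "- k'" "- l'"] E_mult[of k' l' "- k'" "- l'"] by simp
  from E_one[OF this] show "[k = k'] (mod int p) \<and> [l = l'] (mod int q)"
    by (simp add: cong_0_iff cong_iff_dvd_diff)
qed (auto intro: E_cong)

lemma E_cases:
  assumes "x \<in> carrier G" obtains k l :: int where "x = E k l"
  using assms unfolding carrier_eq by (auto simp: E_def int_pow_int[symmetric])

lemma E_nat: "\<sigma> [^] (k :: nat) \<otimes> \<tau> [^] (l :: nat) = E (int k) (int l)"
  by (simp add: E_def int_pow_int)

definition e :: "int \<Rightarrow> int" where "e l = g ^ nat (l mod int q)"

lemma g_pow_cong: "[g ^ a = 1] (mod int p) \<longleftrightarrow> q dvd a"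
proof -
  define h where "h = nat (g mod int p)"
  have h: "int h = g mod int p" using p0 by (simp add: h_def)
  have "[g ^ a = 1] (mod int p) \<longleftrightarrow> [int h ^ a = 1] (mod int p)"
    by (simp add: h cong_def power_mod)
  also have "\<dots> \<longleftrightarrow> [h ^ a = 1] (mod p)"
    by (metis cong_int_iff of_nat_1 of_nat_power)
  also have "\<dots> \<longleftrightarrow> q dvd a" using ord_divides[of h a p] ord_g by (simp add: h_def)
  finally show ?thesis .
qed

lemma e_nat: "[e (int a) = g ^ a] (mod int p)"
proof -
  have "g ^ a = g ^ (a mod q) * (g ^ q) ^ (a div q)"
    by (metis mod_mult_div_eq power_add power_mult)
  moreover have "[(g ^ q) ^ (a div q) = 1 ^ (a div q)] (mod int p)"
    by (rule cong_pow) (simp add: g_pow_cong)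
  ultimately have "[g ^ a = g ^ (a mod q)] (mod int p)"
    using cong_scalar_left[of "(g ^ q) ^ (a div q)" 1 "int p" "g ^ (a mod q)"] by simp
  moreover have "nat (int a mod int q) = a mod q" by (metis nat_int zmod_int)
  ultimately show ?thesis unfolding e_def by (metis cong_sym)
qed

lemma e_cong: "[l = l'] (mod int q) \<Longrightarrow> e l = e l'"
  by (simp add: e_def cong_def)

lemma ex_nat: "\<exists>a :: nat. [l = int a] (mod int q)"
  by (rule exI[of _ "nat (l mod int q)"]) (use q0 in \<open>simp add: cong_def\<close>)

lemma e_add: "[e (l + l') = e l * e l'] (mod int p)"
proof -
  obtain a b where ab: "[l = int a] (mod int q)" "[l' = int b] (mod int q)" using ex_nat by metis
  have "e (l + l') = e (int (a + b))" using cong_add[OF ab] by (simp add: e_cong)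
  moreover have "[e (int (a + b)) = g ^ a * g ^ b] (mod int p)" using e_nat[of "a + b"] by (simp add: power_add)
  moreover have "[e l * e l' = g ^ a * g ^ b] (mod int p)"
    using cong_mult[OF e_nat e_nat, of a b] ab by (simp add: e_cong)
  ultimately show ?thesis by (metis cong_sym cong_trans)
qed

lemma e_0 [simp]: "e 0 = 1" by (simp add: e_def)

lemma e_1: "[e 1 = g] (mod int p)" using e_nat[of 1] by simp

lemma e_neg: "[e l * e (- l) = 1] (mod int p)"
  using cong_sym[OF e_add[of l "- l"]] by simp

definition H :: "('a \<Rightarrow> 'a) set" where
  "H = {f \<in> carrier (Perm G). \<exists>a b. \<forall>k l. f (E k l) = E (k * e b + a) (l + b)}"

definition Hopp :: "('a \<Rightarrow> 'a) set" where
  "Hopp = {f \<in> carrier (Perm G). \<exists>a b. \<forall>k l. f (E k l) = E (k + a * e l) (l + b)}"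

lemma Perm_inv_E:
  assumes "f \<in> carrier (Perm G)" "f (E k l) = E k' l'"
  shows "(inv\<^bsub>Perm G\<^esub> f) (E k' l') = E k l"
  using Perm_inv_apply[OF assms(1) _ assms(2)] by simp

lemma cong_e_neg: "[x * e l * e (- l) = x] (mod int p)"
  using cong_scalar_left[OF e_neg[of l], of x] by (simp add: mult.assoc)

lemma subgroup_H: "subgroup H (Perm G)"
proof -
  interpret P: group "Perm G" by (rule group_BijGroup)
  show ?thesis
  proof (rule P.subgroupI)
    have "\<one>\<^bsub>Perm G\<^esub> \<in> H"
      unfolding H_def by (auto simp: Perm_one_apply intro!: exI[of _ "0 :: int"])
    then show "H \<noteq> {}" by blast
    show "H \<subseteq> carrier (Perm G)" by (auto simp: H_def)
  next
    fix f assume "f \<in> H"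
    then obtain a b where f: "f \<in> carrier (Perm G)" "\<And>k l. f (E k l) = E (k * e b + a) (l + b)"
      unfolding H_def by blast
    have "(inv\<^bsub>Perm G\<^esub> f) (E k l) = E (k * e (- b) + (- a) * e (- b)) (l + (- b))" for k l
    proof (rule Perm_inv_E[OF f(1)])
      have "(k * e (- b) + (- a) * e (- b)) * e b + a = (k - a) * e (- b) * e (- (- b)) + a"
        by (simp add: algebra_simps)
      moreover have "[(k - a) * e (- b) * e (- (- b)) + a = (k - a) + a] (mod int p)"
        by (intro cong_add cong_e_neg cong_refl)
      ultimately show "f (E (k * e (- b) + (- a) * e (- b)) (l + (- b))) = E k l"
        unfolding f(2) by (intro E_cong) auto
    qed
    then show "inv\<^bsub>Perm G\<^esub> f \<in> H" using f(1) unfolding H_def by blast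
  next
    fix f f' assume "f \<in> H" "f' \<in> H"
    then obtain a b a' b' where f: "f \<in> carrier (Perm G)" "\<And>k l. f (E k l) = E (k * e b + a) (l + b)"
      and f': "f' \<in> carrier (Perm G)" "\<And>k l. f' (E k l) = E (k * e b' + a') (l + b')"
      unfolding H_def by blast
    have "(f \<otimes>\<^bsub>Perm G\<^esub> f') (E k l) = E (k * e (b' + b) + (a' * e b + a)) (l + (b' + b))" for k l
    proof -
      have "(f \<otimes>\<^bsub>Perm G\<^esub> f') (E k l) = E ((k * e b' + a') * e b + a) (l + b' + b)"
        using Perm_mult_apply[OF f(1) f'(1), of "E k l"] by (simp add: f f')
      moreover have "(k * e b' + a') * e b + a = k * (e b' * e b) + (a' * e b + a)"
        by (simp add: algebra_simps)
      moreover have "[k * (e b' * e b) + (a' * e b + a) = k * e (b' + b) + (a' * e b + a)] (mod int p)"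
        by (intro cong_add cong_scalar_left cong_sym[OF e_add] cong_refl)
      ultimately show ?thesis by (metis E_cong add.assoc cong_refl)
    qed
    then show "f \<otimes>\<^bsub>Perm G\<^esub> f' \<in> H" using f(1) f'(1) unfolding H_def by blast
  qed
qed

lemma subgroup_Hopp: "subgroup Hopp (Perm G)"
proof -
  interpret P: group "Perm G" by (rule group_BijGroup)
  show ?thesis
  proof (rule P.subgroupI)
    have "\<one>\<^bsub>Perm G\<^esub> \<in> Hopp"
      unfolding Hopp_def by (auto simp: Perm_one_apply intro!: exI[of _ "0 :: int"])
    then show "Hopp \<noteq> {}" by blast
    show "Hopp \<subseteq> carrier (Perm G)" by (auto simp: Hopp_def)
  next
    fix f assume "f \<in> Hopp"
    then obtain a b where f: "f \<in> carrier (Perm G)" "\<And>k l. f (E k l) = E (k + a * e l) (l + b)"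
      unfolding Hopp_def by blast
    have "(inv\<^bsub>Perm G\<^esub> f) (E k l) = E (k + (- a * e (- b)) * e l) (l + (- b))" for k l
    proof (rule Perm_inv_E[OF f(1)])
      have "[(k + (- a * e (- b)) * e l) + a * e (l + (- b)) =
             (k + (- a * e (- b)) * e l) + a * (e l * e (- b))] (mod int p)"
        by (intro cong_add cong_scalar_left e_add cong_refl)
      moreover have "(k + (- a * e (- b)) * e l) + a * (e l * e (- b)) = k"
        by (simp add: algebra_simps)
      ultimately show "f (E (k + (- a * e (- b)) * e l) (l + (- b))) = E k l"
        unfolding f(2) by (intro E_cong) auto
    qed
    then show "inv\<^bsub>Perm G\<^esub> f \<in> Hopp" using f(1) unfolding Hopp_def by blast
  next
    fix f f' assume "f \<in> Hopp" "f' \<in> Hopp"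
    then obtain a b a' b' where f: "f \<in> carrier (Perm G)" "\<And>k l. f (E k l) = E (k + a * e l) (l + b)"
      and f': "f' \<in> carrier (Perm G)" "\<And>k l. f' (E k l) = E (k + a' * e l) (l + b')"
      unfolding Hopp_def by blast
    have "(f \<otimes>\<^bsub>Perm G\<^esub> f') (E k l) = E (k + (a' + a * e b') * e l) (l + (b' + b))" for k l
    proof -
      have "(f \<otimes>\<^bsub>Perm G\<^esub> f') (E k l) = E ((k + a' * e l) + a * e (l + b')) (l + b' + b)"
        using Perm_mult_apply[OF f(1) f'(1), of "E k l"] by (simp add: f f')
      moreover have "[(k + a' * e l) + a * e (l + b') = (k + a' * e l) + a * (e l * e b')] (mod int p)"
        by (intro cong_add cong_scalar_left e_add cong_refl)
      moreover have "(k + a' * e l) + a * (e l * e b') = k + (a' + a * e b') * e l"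
        by (simp add: algebra_simps)
      ultimately show ?thesis by (metis E_cong add.assoc cong_refl)
    qed
    then show "f \<otimes>\<^bsub>Perm G\<^esub> f' \<in> Hopp" using f(1) f'(1) unfolding Hopp_def by blast
  qed
qed

lemma Perm_oneI: "f \<in> carrier (Perm G) \<Longrightarrow> (\<And>k l. f (E k l) = E k l) \<Longrightarrow> f = \<one>\<^bsub>Perm G\<^esub>"
proof (rule Perm_eqI)
  interpret P: group "Perm G" by (rule group_BijGroup)
  show "\<one>\<^bsub>Perm G\<^esub> \<in> carrier (Perm G)" by simp
qed (auto simp: Perm_one_apply elim!: E_cases)

lemma free_H: "x \<in> carrier G \<Longrightarrow> \<nu> \<in> H \<Longrightarrow> \<nu> x = x \<Longrightarrow> \<nu> = \<one>\<^bsub>Perm G\<^esub>"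
proof -
  assume x: "x \<in> carrier G" and "\<nu> \<in> H" and fx: "\<nu> x = x"
  then obtain a b where \<nu>: "\<nu> \<in> carrier (Perm G)" "\<And>k l. \<nu> (E k l) = E (k * e b + a) (l + b)"
    unfolding H_def by blast
  obtain m n where mn: "x = E m n" using x by (rule E_cases)
  have b: "[b = 0] (mod int q)" using fx unfolding mn \<nu>(2) E_eq_iff by (simp add: cong_iff_dvd_diff)
  then have e1: "e b = 1" using e_cong[of b 0] by simp
  have a: "[a = 0] (mod int p)"
    using fx unfolding mn \<nu>(2) E_eq_iff e1 by (simp add: cong_iff_dvd_diff)
  show ?thesis
    by (rule Perm_oneI[OF \<nu>(1)])
       (unfold \<nu>(2) E_eq_iff e1, use a b in \<open>simp add: cong_iff_dvd_diff\<close>)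
qed

lemma free_Hopp: "x \<in> carrier G \<Longrightarrow> \<nu> \<in> Hopp \<Longrightarrow> \<nu> x = x \<Longrightarrow> \<nu> = \<one>\<^bsub>Perm G\<^esub>"
proof -
  assume x: "x \<in> carrier G" and "\<nu> \<in> Hopp" and fx: "\<nu> x = x"
  then obtain a b where \<nu>: "\<nu> \<in> carrier (Perm G)" "\<And>k l. \<nu> (E k l) = E (k + a * e l) (l + b)"
    unfolding Hopp_def by blast
  obtain m n where mn: "x = E m n" using x by (rule E_cases)
  have b: "[b = 0] (mod int q)" using fx unfolding mn \<nu>(2) E_eq_iff by (simp add: cong_iff_dvd_diff)
  have "[a * e n = 0] (mod int p)"
    using fx unfolding mn \<nu>(2) E_eq_iff by (simp add: cong_iff_dvd_diff)
  then have "[a * e n * e (- n) = 0 * e (- n)] (mod int p)" by (rule cong_scalar_right)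
  then have "[a = 0] (mod int p)" using cong_e_neg[of a n] by (metis cong_sym cong_trans mult_zero_left)
  then show ?thesis
    by (intro Perm_oneI[OF \<nu>(1)], unfold \<nu>(2) E_eq_iff)
       (use b in \<open>simp add: cong_iff_dvd_diff\<close>)
qed

lemma stable_H: "G_stable G H"
  unfolding G_stable_def
proof (intro ballI)
  fix x \<nu> assume x: "x \<in> carrier G" and "\<nu> \<in> H"
  then obtain a b where \<nu>: "\<nu> \<in> carrier (Perm G)" "\<And>k l. \<nu> (E k l) = E (k * e b + a) (l + b)"
    unfolding H_def by blast
  obtain m n where mn: "x = E m n" using x by (rule E_cases)
  have "perm_act G x \<nu> (E k l) = E (k * e b + (m - m * e b + a)) (l + b)" for k l
    using perm_act_apply[OF x \<nu>(1) E_closed[of k l]]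
    by (simp add: mn E_inv E_mult \<nu>(2) algebra_simps)
  then show "perm_act G x \<nu> \<in> H" using perm_act_closed[OF x \<nu>(1)] unfolding H_def by blast
qed

lemma stable_Hopp: "G_stable G Hopp"
  unfolding G_stable_def
proof (intro ballI)
  fix x \<nu> assume x: "x \<in> carrier G" and "\<nu> \<in> Hopp"
  then obtain a b where \<nu>: "\<nu> \<in> carrier (Perm G)" "\<And>k l. \<nu> (E k l) = E (k + a * e l) (l + b)"
    unfolding Hopp_def by blast
  obtain m n where mn: "x = E m n" using x by (rule E_cases)
  have "perm_act G x \<nu> (E k l) = E (k + (a * e (- n)) * e l) (l + b)" for k l
  proof -
    have "perm_act G x \<nu> (E k l) = E (k + a * e (- n + l)) (l + b)"
      using perm_act_apply[OF x \<nu>(1) E_closed[of k l]]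
    by (simp add: mn E_inv E_mult \<nu>(2) algebra_simps)
    moreover have "[k + a * e (- n + l) = k + a * (e (- n) * e l)] (mod int p)"
      by (intro cong_add cong_scalar_left e_add cong_refl)
    ultimately show ?thesis by (metis E_cong cong_refl mult.assoc)
  qed
  then show "perm_act G x \<nu> \<in> Hopp" using perm_act_closed[OF x \<nu>(1)] unfolding Hopp_def by blast
qed

lemma E_nat_cases:
  obtains i j :: nat where "i \<in> {0..p - 1}" "j \<in> {0..q - 1}"
    "[k = int i] (mod int p)" "[l = int j] (mod int q)" "E k l = \<sigma> [^] i \<otimes> \<tau> [^] j"
proof -
  have *: "nat (k mod int n) \<in> {0..n - 1} \<and> [k = int (nat (k mod int n))] (mod int n)" if "0 < n" for k n
  proof -
    have "nat (k mod int n) < n"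
      using that pos_mod_bound[of "int n" k] pos_mod_sign[of "int n" k] by linarith
    then show ?thesis using that by (auto simp: cong_def)
  qed
  show ?thesis
    using that *[OF p0, of k] *[OF q0, of l] E_nat E_cong by metis
qed

lemma regular_stable_H:
  assumes \<eta>: "\<eta> \<in> carrier (Perm G)"
      "\<forall>k \<in> {0..p - 1}. \<forall>l \<in> {0..q - 1}. \<eta> (\<sigma> [^] k \<otimes> \<tau> [^] l) = \<sigma> [^] (k + 1) \<otimes> \<tau> [^] l"
    and \<pi>: "\<pi> \<in> carrier (Perm G)"
      "\<forall>k \<in> {0..p - 1}. \<forall>l \<in> {0..q - 1}.
         \<pi> (\<sigma> [^] k \<otimes> \<tau> [^] l) = \<sigma> [^] (int k * g) \<otimes> \<tau> [^] (l + 1)"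
  shows "regular_subgroup G (generate (Perm G) {\<eta>, \<pi>}) \<and> G_stable G (generate (Perm G) {\<eta>, \<pi>})"
proof -
  interpret P: group "Perm G" by (rule group_BijGroup)
  let ?X = "generate (Perm G) {\<eta>, \<pi>}"
  have \<eta>E: "\<eta> (E k l) = E (k + 1) l" for k l
  proof (rule E_nat_cases[of k l])
    fix i j :: nat assume ij: "i \<in> {0..p - 1}" "j \<in> {0..q - 1}" "[k = int i] (mod int p)"
      "[l = int j] (mod int q)" "E k l = \<sigma> [^] i \<otimes> \<tau> [^] j"
    then have "\<eta> (E k l) = E (int i + 1) (int j)" using \<eta>(2) E_nat[of "i + 1" j] by (simp add: add.commute)
    also have "\<dots> = E (k + 1) l" using ij by (intro E_cong cong_add) (auto intro: cong_sym)
    finally show ?thesis .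
  qed
  have \<pi>E: "\<pi> (E k l) = E (k * e 1) (l + 1)" for k l
  proof (rule E_nat_cases[of k l])
    fix i j :: nat assume ij: "i \<in> {0..p - 1}" "j \<in> {0..q - 1}" "[k = int i] (mod int p)"
      "[l = int j] (mod int q)" "E k l = \<sigma> [^] i \<otimes> \<tau> [^] j"
    then have "\<pi> (E k l) = E (int i * g) (int j + 1)"
      using \<pi>(2) by (simp add: E_def int_pow_int[symmetric] add.commute)
    also have "\<dots> = E (k * e 1) (l + 1)"
      using ij by (intro E_cong cong_add cong_mult) (auto intro: cong_sym e_1)
    finally show ?thesis .
  qed
  have X: "subgroup ?X (Perm G)" using \<eta> \<pi> by (intro P.generate_is_subgroup) auto
  have "\<eta> (E k l) = E (k * e 0 + 1) (l + 0)" for k l by (simp add: \<eta>E)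
  moreover have "\<pi> (E k l) = E (k * e 1 + 0) (l + 1)" for k l by (simp add: \<pi>E)
  ultimately have "{\<eta>, \<pi>} \<subseteq> H" using \<eta>(1) \<pi>(1) unfolding H_def by blast
  then have XH: "?X \<subseteq> H" by (rule P.generate_subgroup_incl[OF _ subgroup_H])
  have step: "\<exists>\<nu> \<in> ?X. \<nu> \<one> = f y" if pre: "\<exists>\<nu> \<in> ?X. \<nu> \<one> = y" and mem: "f \<in> {\<eta>, \<pi>}" for f y
  proof -
    obtain \<nu> where \<nu>: "\<nu> \<in> ?X" "\<nu> \<one> = y" using pre by blast
    have f: "f \<in> ?X" using mem by (rule generate.incl)
    have "(f \<otimes>\<^bsub>Perm G\<^esub> \<nu>) \<one> = f y"
      using Perm_mult_apply[of f G \<nu> \<one>] \<nu> f subgroup.subset[OF X] by auto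
    then show ?thesis using subgroup.m_closed[OF X f \<nu>(1)] by blast
  qed
  have one: "\<exists>\<nu> \<in> ?X. \<nu> \<one> = E 0 0"
    using subgroup.one_closed[OF X] Perm_one_apply[of \<one> G] by auto
  have "\<exists>\<nu> \<in> ?X. \<nu> \<one> = E 0 (int b)" for b
  proof (induction b)
    case (Suc b)
    then show ?case using step[OF Suc, of \<pi>] \<pi>E[of 0 "int b"] by (simp add: add.commute)
  qed (use one in simp)
  then have "\<exists>\<nu> \<in> ?X. \<nu> \<one> = E (int a) (int b)" for a b
  proof (induction a)
    case (Suc a)
    then show ?case using step[OF Suc.IH[OF Suc.prems], of \<eta>] \<eta>E[of "int a" "int b"] by (simp add: add.commute)
  qed simp
  then have "\<exists>\<nu> \<in> ?X. \<nu> \<one> = x" if "x \<in> carrier G" for x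
    using that unfolding carrier_eq by (auto simp: E_nat)
  then have "?X = H \<and> regular_subgroup G ?X"
    using free_H by (intro regular_criterion[OF X subgroup_H XH]) blast+
  then show ?thesis using stable_H by auto
qed

lemma regular_stable_Hopp:
  assumes \<eta>': "\<eta>' \<in> carrier (Perm G)"
      "\<forall>k \<in> {0..p - 1}. \<forall>l \<in> {0..q - 1}.
         \<eta>' (\<sigma> [^] k \<otimes> \<tau> [^] l) = \<sigma> [^] (int k + g ^ l) \<otimes> \<tau> [^] l"
    and \<pi>': "\<pi>' \<in> carrier (Perm G)"
      "\<forall>k \<in> {0..p - 1}. \<forall>l \<in> {0..q - 1}. \<pi>' (\<sigma> [^] k \<otimes> \<tau> [^] l) = \<sigma> [^] k \<otimes> \<tau> [^] (l + 1)"
  shows "regular_subgroup G (generate (Perm G) {\<eta>', \<pi>'}) \<and> G_stable G (generate (Perm G) {\<eta>', \<pi>'})"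
proof -
  interpret P: group "Perm G" by (rule group_BijGroup)
  let ?X = "generate (Perm G) {\<eta>', \<pi>'}"
  have \<pi>E: "\<pi>' (E k l) = E k (l + 1)" for k l
  proof (rule E_nat_cases[of k l])
    fix i j :: nat assume ij: "i \<in> {0..p - 1}" "j \<in> {0..q - 1}" "[k = int i] (mod int p)"
      "[l = int j] (mod int q)" "E k l = \<sigma> [^] i \<otimes> \<tau> [^] j"
    then have "\<pi>' (E k l) = E (int i) (int j + 1)" using \<pi>'(2) E_nat[of i "j + 1"] by (simp add: add.commute)
    also have "\<dots> = E k (l + 1)" using ij by (intro E_cong cong_add) (auto intro: cong_sym)
    finally show ?thesis .
  qed
  have \<eta>E: "\<eta>' (E k l) = E (k + e l) l" for k l
  proof (rule E_nat_cases[of k l])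
    fix i j :: nat assume ij: "i \<in> {0..p - 1}" "j \<in> {0..q - 1}" "[k = int i] (mod int p)"
      "[l = int j] (mod int q)" "E k l = \<sigma> [^] i \<otimes> \<tau> [^] j"
    then have "\<eta>' (E k l) = E (int i + g ^ j) (int j)"
      using \<eta>'(2) by (simp add: E_def int_pow_int[symmetric])
    also have "\<dots> = E (k + e l) l"
      using ij e_nat[of j] e_cong[OF ij(4)] by (intro E_cong cong_add) (auto intro: cong_sym)
    finally show ?thesis .
  qed
  have X: "subgroup ?X (Perm G)" using \<eta>' \<pi>' by (intro P.generate_is_subgroup) auto
  have "\<eta>' (E k l) = E (k + 1 * e l) (l + 0)" for k l by (simp add: \<eta>E)
  moreover have "\<pi>' (E k l) = E (k + 0 * e l) (l + 1)" for k l by (simp add: \<pi>E)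
  ultimately have "{\<eta>', \<pi>'} \<subseteq> Hopp" using \<eta>'(1) \<pi>'(1) unfolding Hopp_def by blast
  then have XH: "?X \<subseteq> Hopp" by (rule P.generate_subgroup_incl[OF _ subgroup_Hopp])
  have step: "\<exists>\<nu> \<in> ?X. \<nu> \<one> = f y" if pre: "\<exists>\<nu> \<in> ?X. \<nu> \<one> = y" and mem: "f \<in> {\<eta>', \<pi>'}" for f y
  proof -
    obtain \<nu> where \<nu>: "\<nu> \<in> ?X" "\<nu> \<one> = y" using pre by blast
    have f: "f \<in> ?X" using mem by (rule generate.incl)
    have "(f \<otimes>\<^bsub>Perm G\<^esub> \<nu>) \<one> = f y"
      using Perm_mult_apply[of f G \<nu> \<one>] \<nu> f subgroup.subset[OF X] by auto
    then show ?thesis using subgroup.m_closed[OF X f \<nu>(1)] by blast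
  qed
  have one: "\<exists>\<nu> \<in> ?X. \<nu> \<one> = E 0 0"
    using subgroup.one_closed[OF X] Perm_one_apply[of \<one> G] by auto
  have "\<exists>\<nu> \<in> ?X. \<nu> \<one> = E (int a) 0" for a
  proof (induction a)
    case (Suc a)
    then show ?case using step[OF Suc, of \<eta>'] \<eta>E[of "int a" 0] by (simp add: add.commute)
  qed (use one in simp)
  then have "\<exists>\<nu> \<in> ?X. \<nu> \<one> = E (int a) (int b)" for a b
  proof (induction b)
    case (Suc b)
    then show ?case using step[OF Suc.IH[OF Suc.prems], of \<pi>'] \<pi>E[of "int a" "int b"] by (simp add: add.commute)
  qed simp
  then have "\<exists>\<nu> \<in> ?X. \<nu> \<one> = x" if "x \<in> carrier G" for x
    using that unfolding carrier_eq by (auto simp: E_nat)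
  then have "?X = Hopp \<and> regular_subgroup G ?X"
    using free_Hopp by (intro regular_criterion[OF X subgroup_Hopp XH]) blast+
  then show ?thesis using stable_Hopp by auto
qed

end

lemma conj_N_regular_stable:
  fixes G :: "('a, 'b) monoid_scheme" and p q :: nat and g :: int
  assumes "prime p" and "prime q" and "p > q" and "Pocklington.ord p (nat (g mod int p)) = q"
    and "group G" and "cyclic_group G"
    and "\<sigma> \<in> carrier G" and "group.ord G \<sigma> = p"
    and "\<tau> \<in> carrier G" and "group.ord G \<tau> = q"
    and "carrier G = {\<sigma> [^]\<^bsub>G\<^esub> i \<otimes>\<^bsub>G\<^esub> \<tau> [^]\<^bsub>G\<^esub> j | (i :: nat) (j :: nat). i \<le> p - 1 \<and> j \<le> q - 1}"
    and "\<eta> \<in> carrier (Perm G)"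
    and "\<forall>k \<in> {0..p - 1}. \<forall>l \<in> {0..q - 1}.
           \<eta> (\<sigma> [^]\<^bsub>G\<^esub> k \<otimes>\<^bsub>G\<^esub> \<tau> [^]\<^bsub>G\<^esub> l) = \<sigma> [^]\<^bsub>G\<^esub> (k + 1) \<otimes>\<^bsub>G\<^esub> \<tau> [^]\<^bsub>G\<^esub> l"
    and "\<pi> \<in> carrier (Perm G)"
    and "\<forall>k \<in> {0..p - 1}. \<forall>l \<in> {0..q - 1}.
           \<pi> (\<sigma> [^]\<^bsub>G\<^esub> k \<otimes>\<^bsub>G\<^esub> \<tau> [^]\<^bsub>G\<^esub> l) = \<sigma> [^]\<^bsub>G\<^esub> (int k * g) \<otimes>\<^bsub>G\<^esub> \<tau> [^]\<^bsub>G\<^esub> (l + 1)"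
    and "f \<in> auto G"
  shows "regular_subgroup G (conj_by G f (generate (Perm G) {\<eta>, \<pi>})) \<and>
         G_stable G (conj_by G f (generate (Perm G) {\<eta>, \<pi>}))"
proof -
  have "comm_group G" using group.cyclic_imp_abelian_group assms by blast
  then interpret cyclic_pq G p q g \<sigma> \<tau>
    using assms by (intro cyclic_pq.intro cyclic_pq_axioms.intro)
  show ?thesis using conj_by_regular_stable regular_stable_H assms by blast
qed

lemma conj_Nopp_regular_stable:
  fixes G :: "('a, 'b) monoid_scheme" and p q :: nat and g :: int
  assumes "prime p" and "prime q" and "p > q" and "Pocklington.ord p (nat (g mod int p)) = q"
    and "group G" and "cyclic_group G"
    and "\<sigma> \<in> carrier G" and "group.ord G \<sigma> = p"
    and "\<tau> \<in> carrier G" and "group.ord G \<tau> = q"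
    and "carrier G = {\<sigma> [^]\<^bsub>G\<^esub> i \<otimes>\<^bsub>G\<^esub> \<tau> [^]\<^bsub>G\<^esub> j | (i :: nat) (j :: nat). i \<le> p - 1 \<and> j \<le> q - 1}"
    and "\<eta>' \<in> carrier (Perm G)"
    and "\<forall>k \<in> {0..p - 1}. \<forall>l \<in> {0..q - 1}.
           \<eta>' (\<sigma> [^]\<^bsub>G\<^esub> k \<otimes>\<^bsub>G\<^esub> \<tau> [^]\<^bsub>G\<^esub> l) = \<sigma> [^]\<^bsub>G\<^esub> (int k + g ^ l) \<otimes>\<^bsub>G\<^esub> \<tau> [^]\<^bsub>G\<^esub> l"
    and "\<pi>' \<in> carrier (Perm G)"
    and "\<forall>k \<in> {0..p - 1}. \<forall>l \<in> {0..q - 1}.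
           \<pi>' (\<sigma> [^]\<^bsub>G\<^esub> k \<otimes>\<^bsub>G\<^esub> \<tau> [^]\<^bsub>G\<^esub> l) = \<sigma> [^]\<^bsub>G\<^esub> k \<otimes>\<^bsub>G\<^esub> \<tau> [^]\<^bsub>G\<^esub> (l + 1)"
    and "f \<in> auto G"
  shows "regular_subgroup G (conj_by G f (generate (Perm G) {\<eta>', \<pi>'})) \<and>
         G_stable G (conj_by G f (generate (Perm G) {\<eta>', \<pi>'}))"
proof -
  have "comm_group G" using group.cyclic_imp_abelian_group assms by blast
  then interpret cyclic_pq G p q g \<sigma> \<tau>
    using assms by (intro cyclic_pq.intro cyclic_pq_axioms.intro)
  show ?thesis using conj_by_regular_stable regular_stable_Hopp assms by blast
qed

end

theory Submission
  imports Defs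
begin

text \<open>
  Everything is computed in the coordinates \<open>E k l = \<sigma>^k \<tau>^l\<close>, with \<open>k\<close> modulo \<open>p\<close> and \<open>l\<close> modulo \<open>q\<close>.
  Write \<open>e l\<close> for \<open>g^l\<close> modulo \<open>p\<close>. Then \<open>N_t\<close> consists of the maps
  \<open>E k l \<mapsto> E (k * e (t * b) + a) (l + b)\<close>, and \<open>N_t^opp\<close> of the maps
  \<open>E k l \<mapsto> E (k + a * e (t * l)) (l + b)\<close>. Since \<open>G\<close> is abelian, the action of an element of \<open>G\<close> on
  either kind of map only changes the parameter \<open>a\<close>, and three observations decide the question.

  On \<open>N_t\<close> the element \<open>\<tau>\<close> acts trivially. By the Chinese remainder theorem there is an
  automorphism \<open>w\<close> of \<open>G\<close> that fixes \<open>\<sigma>\<close> and sends \<open>\<tau>\<close> to \<open>\<tau>^(t/s)\<close>. Conjugation by \<open>w\<close> carries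
  \<open>N_s\<close> onto \<open>N_t\<close>. It replaces the action of \<open>x\<close> by that of \<open>w x\<close>, which is the same action because
  \<open>x\<close> and \<open>w x\<close> differ by a power of \<open>\<tau>\<close> (\<open>G_isomorphic_H_fam\<close>).

  On \<open>N_t^opp\<close> the element \<open>\<tau>\<close> does act: its inverse raises each element of order \<open>p\<close> to the power
  \<open>g^t\<close>. This exponent modulo \<open>p\<close> is an invariant of \<open>G\<close>-isomorphism, and it determines \<open>t\<close> modulo
  \<open>q\<close> because \<open>g\<close> has order \<open>q\<close> (\<open>G_isomorphic_Hopp_fam_imp_cong\<close>).

  Finally, \<open>\<sigma>\<close> acts trivially on \<open>N_s^opp\<close> but not on \<open>N_t\<close>, where it moves every element with
  \<open>b\<close> prime to \<open>q\<close> (\<open>Hopp_fam_not_G_isomorphic_H_fam\<close>).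
\<close>

section \<open>Permutation groups with an action of G\<close>

context group
begin

lemma auto_intertwines_left_reg:
  assumes f: "f \<in> auto G" and x: "x \<in> carrier G"
  shows "f \<otimes>\<^bsub>Perm G\<^esub> left_reg G x = left_reg G (f x) \<otimes>\<^bsub>Perm G\<^esub> f"
proof (rule Perm_eqI)
  interpret P: group "Perm G" by (rule group_BijGroup)
  have fP: "f \<in> carrier (Perm G)" and fhom: "f \<in> hom G G"
    using f by (auto simp: auto_def BijGroup_def)
  have fx: "f x \<in> carrier G" using Perm_closed_apply[OF fP x] .
  note L = left_reg_closed[OF x] left_reg_closed[OF fx]
  show "f \<otimes>\<^bsub>Perm G\<^esub> left_reg G x \<in> carrier (Perm G)"
    "left_reg G (f x) \<otimes>\<^bsub>Perm G\<^esub> f \<in> carrier (Perm G)"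
    using fP L by auto
  fix y assume y: "y \<in> carrier G"
  have "f (left_reg G x y) = left_reg G (f x) (f y)"
    using x y fx Perm_closed_apply[OF fP y] hom_mult[OF fhom] by (simp add: left_reg_def)
  then show "(f \<otimes>\<^bsub>Perm G\<^esub> left_reg G x) y = (left_reg G (f x) \<otimes>\<^bsub>Perm G\<^esub> f) y"
    using Perm_mult_apply[OF fP L(1) y] Perm_mult_apply[OF L(2) fP y] by simp
qed

text \<open>
  Expanding the action as conjugation by left translations, this follows from \<open>f L_x = L_(f x) f\<close>,
  which expresses that \<open>f\<close> is a homomorphism.
\<close>

lemma perm_act_conj:
  assumes f: "f \<in> auto G" and x: "x \<in> carrier G" and \<nu>: "\<nu> \<in> carrier (Perm G)"
  shows "perm_act G x (inv\<^bsub>Perm G\<^esub> f \<otimes>\<^bsub>Perm G\<^esub> \<nu> \<otimes>\<^bsub>Perm G\<^esub> f) =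
         inv\<^bsub>Perm G\<^esub> f \<otimes>\<^bsub>Perm G\<^esub> perm_act G (f x) \<nu> \<otimes>\<^bsub>Perm G\<^esub> f"
proof -
  interpret P: group "Perm G" by (rule group_BijGroup)
  have fP: "f \<in> carrier (Perm G)" using f by (auto simp: auto_def BijGroup_def)
  have fx: "f x \<in> carrier G" using Perm_closed_apply[OF fP x] .
  note L = left_reg_closed[OF x] left_reg_closed[OF fx]
  have *: "left_reg G x = inv\<^bsub>Perm G\<^esub> f \<otimes>\<^bsub>Perm G\<^esub> (left_reg G (f x) \<otimes>\<^bsub>Perm G\<^esub> f)"
    using auto_intertwines_left_reg[OF f x] fP L by (simp add: P.inv_solve_left)
  have cancel: "f \<otimes>\<^bsub>Perm G\<^esub> (inv\<^bsub>Perm G\<^esub> f \<otimes>\<^bsub>Perm G\<^esub> \<mu>) = \<mu>"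
    if "\<mu> \<in> carrier (Perm G)" for \<mu>
    using that fP by (simp add: P.m_assoc[symmetric])
  show ?thesis
    unfolding perm_act_def * using fP L \<nu>
    by (simp add: P.m_assoc P.inv_mult_group cancel)
qed

text \<open>
  Conjugation by an automorphism \<open>f\<close> turns the action of \<open>f x\<close> into the action of \<open>x\<close>. It is thus
  \<open>G\<close>-equivariant as soon as \<open>f\<close> moves each element of \<open>G\<close> only inside its coset modulo the kernel
  of the action on \<open>N\<close>.
\<close>

lemma G_isomorphic_conj_by:
  assumes f: "f \<in> auto G" and N: "subgroup N (Perm G)"
    and act: "\<And>x \<nu>. x \<in> carrier G \<Longrightarrow> \<nu> \<in> N \<Longrightarrow> perm_act G (f x) \<nu> = perm_act G x \<nu>"
  shows "G_isomorphic G N (conj_by G f N)"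
proof -
  interpret P: group "Perm G" by (rule group_BijGroup)
  have fP: "f \<in> carrier (Perm G)" using f by (auto simp: auto_def BijGroup_def)
  note NP = subsetD[OF subgroup.subset[OF N]]
  define c where "c \<nu> = inv\<^bsub>Perm G\<^esub> f \<otimes>\<^bsub>Perm G\<^esub> \<nu> \<otimes>\<^bsub>Perm G\<^esub> f" for \<nu>
  have cN: "conj_by G f N = c ` N" by (auto simp: conj_by_def c_def)
  have cancel: "f \<otimes>\<^bsub>Perm G\<^esub> (inv\<^bsub>Perm G\<^esub> f \<otimes>\<^bsub>Perm G\<^esub> \<mu>) = \<mu>"
    if "\<mu> \<in> carrier (Perm G)" for \<mu>
    using that fP by (simp add: P.m_assoc[symmetric])
  have "c (\<mu> \<otimes>\<^bsub>Perm G\<^esub> \<nu>) = c \<mu> \<otimes>\<^bsub>Perm G\<^esub> c \<nu>" if "\<mu> \<in> N" "\<nu> \<in> N" for \<mu> \<nu>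
    using NP[OF that(1)] NP[OF that(2)] fP by (simp add: c_def P.m_assoc cancel)
  moreover have "inj_on c N"
    by (rule inj_onI) (use NP fP in \<open>simp add: c_def\<close>)
  ultimately have "c \<in> iso (Perm G\<lparr>carrier := N\<rparr>) (Perm G\<lparr>carrier := conj_by G f N\<rparr>)"
    unfolding cN by (auto simp: iso_def hom_def bij_betw_def)
  moreover have "c (perm_act G x \<nu>) = perm_act G x (c \<nu>)" if "x \<in> carrier G" "\<nu> \<in> N" for x \<nu>
    using perm_act_conj[OF f that(1) NP[OF that(2)]] act[OF that] by (simp add: c_def)
  ultimately show ?thesis unfolding G_isomorphic_def by blast
qed

text \<open>
  An invariant of \<open>G\<close>-isomorphism: on the elements killed by \<open>n\<close>, the element \<open>x\<close> acts as raising to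
  the power \<open>m\<close>. For \<open>n = 0\<close> and \<open>m = 1\<close> it says that \<open>x\<close> acts trivially on the whole subgroup.
\<close>

lemma G_isomorphic_power_act:
  assumes iso: "G_isomorphic G N M"
    and N: "subgroup N (Perm G)" and M: "subgroup M (Perm G)" and x: "x \<in> carrier G"
    and act: "\<And>\<nu>. \<nu> \<in> N \<Longrightarrow> \<nu> [^]\<^bsub>Perm G\<^esub> (n :: nat) = \<one>\<^bsub>Perm G\<^esub> \<Longrightarrow>
                 perm_act G x \<nu> = \<nu> [^]\<^bsub>Perm G\<^esub> (m :: nat)"
    and \<mu>: "\<mu> \<in> M" "\<mu> [^]\<^bsub>Perm G\<^esub> n = \<one>\<^bsub>Perm G\<^esub>"
  shows "perm_act G x \<mu> = \<mu> [^]\<^bsub>Perm G\<^esub> m"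
proof -
  interpret P: group "Perm G" by (rule group_BijGroup)
  obtain \<theta> where \<theta>: "\<theta> \<in> iso (Perm G\<lparr>carrier := N\<rparr>) (Perm G\<lparr>carrier := M\<rparr>)"
    and eq: "\<And>\<nu>. \<nu> \<in> N \<Longrightarrow> \<theta> (perm_act G x \<nu>) = perm_act G x (\<theta> \<nu>)"
    using iso x unfolding G_isomorphic_def by blast
  have hom: "\<theta> \<in> hom (Perm G\<lparr>carrier := N\<rparr>) (Perm G\<lparr>carrier := M\<rparr>)"
    and bij: "bij_betw \<theta> N M" using \<theta> by (auto simp: iso_def)
  have gN: "group (Perm G\<lparr>carrier := N\<rparr>)" and gM: "group (Perm G\<lparr>carrier := M\<rparr>)"
    using N M by (auto intro: subgroup.subgroup_is_group)
  have pow: "\<theta> (\<nu> [^]\<^bsub>Perm G\<^esub> i) = \<theta> \<nu> [^]\<^bsub>Perm G\<^esub> i" if "\<nu> \<in> N" for \<nu> and i :: nat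
    using hom_nat_pow[OF hom _ gN gM, of \<nu> i] that by (simp flip: P.nat_pow_consistent)
  obtain \<nu> where \<nu>: "\<nu> \<in> N" "\<theta> \<nu> = \<mu>" using bij \<mu> by (metis bij_betw_def imageE)
  have closed: "\<nu> [^]\<^bsub>Perm G\<^esub> n \<in> N"
    using N \<nu> P.nat_pow_consistent monoid.nat_pow_closed[OF group.is_monoid[OF gN], of \<nu> n] by simp
  have "\<theta> (\<nu> [^]\<^bsub>Perm G\<^esub> n) = \<theta> \<one>\<^bsub>Perm G\<^esub>"
    using pow[OF \<nu>(1), of n] pow[OF \<nu>(1), of 0] \<nu> \<mu> by simp
  then have "\<nu> [^]\<^bsub>Perm G\<^esub> n = \<one>\<^bsub>Perm G\<^esub>"
    using bij closed subgroup.one_closed[OF N] unfolding bij_betw_def inj_on_def by blast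
  then have "perm_act G x \<nu> = \<nu> [^]\<^bsub>Perm G\<^esub> m" using act \<nu> by blast
  then show ?thesis using eq[OF \<nu>(1)] pow[OF \<nu>(1), of m] \<nu>(2) by simp
qed

end

section \<open>Explicit forms of the conjugated subgroups\<close>

context cyclic_pq
begin

text \<open>
  \<open>H_fam t\<close> and \<open>Hopp_fam t\<close> are coordinate descriptions of \<open>N_t\<close> and \<open>N_t^opp\<close>. The scaling of the
  exponent of \<open>\<sigma>\<close> by \<open>\<phi>_t\<close> is absorbed in the parameter \<open>a\<close>; only the scaling of the exponent of
  \<open>\<tau>\<close> leaves a trace.
\<close>

definition H_fam :: "int \<Rightarrow> ('a \<Rightarrow> 'a) set" where
  "H_fam v = {f \<in> carrier (Perm G). \<exists>a b. \<forall>k l. f (E k l) = E (k * e (v * b) + a) (l + b)}"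

definition Hopp_fam :: "int \<Rightarrow> ('a \<Rightarrow> 'a) set" where
  "Hopp_fam v = {f \<in> carrier (Perm G). \<exists>a b. \<forall>k l. f (E k l) = E (k + a * e (v * l)) (l + b)}"

lemma H_fam_1: "H_fam 1 = H"
  by (simp add: H_fam_def H_def)

lemma H_fam_cong:
  assumes "[v = v'] (mod int q)" shows "H_fam v = H_fam v'"
proof -
  have "e (v * b) = e (v' * b)" for b using assms by (intro e_cong cong_scalar_right)
  then show ?thesis by (simp add: H_fam_def)
qed

lemma hom_E:
  assumes f: "f \<in> hom G G" and "f \<sigma> = \<sigma> [^] (u :: int)" "f \<tau> = \<tau> [^] (v :: int)"
  shows "f (E k l) = E (u * k) (v * l)"
  using assms \<sigma> \<tau> hom_mult[OF f, of "\<sigma> [^] k" "\<tau> [^] l"]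
  by (simp add: E_def hom_int_pow[OF f _ is_group is_group] int_pow_pow)

lemma Perm_eqI_E:
  assumes "f \<in> carrier (Perm G)" "h \<in> carrier (Perm G)" "\<And>k l. f (E k l) = h (E k l)"
  shows "f = h"
  using assms by (intro Perm_eqI) (auto elim: E_cases)

lemma conj_closed:
  assumes "f \<in> carrier (Perm G)" "\<nu> \<in> carrier (Perm G)"
  shows "inv\<^bsub>Perm G\<^esub> f \<otimes>\<^bsub>Perm G\<^esub> \<nu> \<otimes>\<^bsub>Perm G\<^esub> f \<in> carrier (Perm G)"
proof -
  interpret P: group "Perm G" by (rule group_BijGroup)
  show ?thesis using assms by simp
qed

lemma conj_apply:
  assumes f: "f \<in> carrier (Perm G)" and \<nu>: "\<nu> \<in> carrier (Perm G)"
    and x: "x \<in> carrier G" and y: "y \<in> carrier G" "f y = \<nu> (f x)"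
  shows "(inv\<^bsub>Perm G\<^esub> f \<otimes>\<^bsub>Perm G\<^esub> \<nu> \<otimes>\<^bsub>Perm G\<^esub> f) x = y"
proof -
  interpret P: group "Perm G" by (rule group_BijGroup)
  have "(inv\<^bsub>Perm G\<^esub> f \<otimes>\<^bsub>Perm G\<^esub> \<nu> \<otimes>\<^bsub>Perm G\<^esub> f) x = (inv\<^bsub>Perm G\<^esub> f) (\<nu> (f x))"
    using f \<nu> x by (simp add: Perm_mult_apply Perm_closed_apply)
  then show ?thesis using Perm_inv_apply[OF f y] by simp
qed

text \<open>
  In the composite \<open>f\<inverse> \<nu> f\<close> the factor \<open>u\<close> by which \<open>f\<close> scales \<open>k\<close> cancels in the linear part, so
  that it changes only the parameter \<open>a\<close> (to \<open>a / u\<close>); the parameter \<open>b\<close> becomes \<open>b / v\<close>, whence the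
  linear coefficient \<open>e (w * b)\<close> is \<open>e (w * v * (b / v))\<close>. Both divisions are possible because \<open>u\<close> and
  \<open>v\<close> are units, and for the same reason every element of the target family is reached.
\<close>

lemma conj_by_H_fam:
  assumes f: "f \<in> carrier (Perm G)" and fE: "\<And>k l. f (E k l) = E (u * k) (v * l)"
    and u: "[u * u' = 1] (mod int p)" and v: "[v * v' = 1] (mod int q)"
  shows "conj_by G f (H_fam w) = H_fam (w * v)"
proof
  interpret P: group "Perm G" by (rule group_BijGroup)
  show "conj_by G f (H_fam w) \<subseteq> H_fam (w * v)"
  proof (clarsimp simp: conj_by_def)
    fix \<nu> assume "\<nu> \<in> H_fam w"
    then obtain a b where \<nu>: "\<nu> \<in> carrier (Perm G)" "\<And>k l. \<nu> (E k l) = E (k * e (w * b) + a) (l + b)"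
      unfolding H_fam_def by blast
    have vb: "[v * (v' * b) = b] (mod int q)" using cong_scalar_right[OF v, of b] by (simp add: mult.assoc)
    have ua: "[u * (u' * a) = a] (mod int p)" using cong_scalar_right[OF u, of a] by (simp add: mult.assoc)
    have eb: "e (w * v * (v' * b)) = e (w * b)"
      using cong_scalar_left[OF vb, of w] by (intro e_cong) (simp add: mult.assoc)
    have "(inv\<^bsub>Perm G\<^esub> f \<otimes>\<^bsub>Perm G\<^esub> \<nu> \<otimes>\<^bsub>Perm G\<^esub> f) (E k l) =
        E (k * e (w * v * (v' * b)) + u' * a) (l + v' * b)" for k l
    proof (rule conj_apply[OF f \<nu>(1)])
      have "[u * (k * e (w * b) + u' * a) = u * k * e (w * b) + a] (mod int p)"
        using cong_add[OF cong_refl ua, of "u * k * e (w * b)"] by (simp add: algebra_simps)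
      moreover have "[v * (l + v' * b) = v * l + b] (mod int q)"
        using cong_add[OF cong_refl vb, of "v * l"] by (simp add: algebra_simps)
      ultimately show "f (E (k * e (w * v * (v' * b)) + u' * a) (l + v' * b)) = \<nu> (f (E k l))"
        unfolding fE \<nu>(2) eb by (rule E_cong)
    qed auto
    then show "inv\<^bsub>Perm G\<^esub> f \<otimes>\<^bsub>Perm G\<^esub> \<nu> \<otimes>\<^bsub>Perm G\<^esub> f \<in> H_fam (w * v)"
      using conj_closed[OF f \<nu>(1)] unfolding H_fam_def by blast
  qed
  show "H_fam (w * v) \<subseteq> conj_by G f (H_fam w)"
  proof
    fix \<mu> assume "\<mu> \<in> H_fam (w * v)"
    then obtain a b where \<mu>: "\<mu> \<in> carrier (Perm G)"
      "\<And>k l. \<mu> (E k l) = E (k * e (w * v * b) + a) (l + b)"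
      unfolding H_fam_def by blast
    define \<nu> where "\<nu> = f \<otimes>\<^bsub>Perm G\<^esub> \<mu> \<otimes>\<^bsub>Perm G\<^esub> inv\<^bsub>Perm G\<^esub> f"
    have \<nu>P: "\<nu> \<in> carrier (Perm G)" using f \<mu> by (simp add: \<nu>_def)
    have "\<nu> (E k l) = E (k * e (w * (v * b)) + u * a) (l + v * b)" for k l
    proof -
      have k: "[u * (u' * k) = k] (mod int p)" using cong_scalar_right[OF u, of k] by (simp add: mult.assoc)
      have l: "[v * (v' * l) = l] (mod int q)" using cong_scalar_right[OF v, of l] by (simp add: mult.assoc)
      have "f (E (u' * k) (v' * l)) = E k l" unfolding fE by (rule E_cong[OF k l])
      then have i: "(inv\<^bsub>Perm G\<^esub> f) (E k l) = E (u' * k) (v' * l)" by (intro Perm_inv_apply f) auto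
      have "\<nu> (E k l) = f (\<mu> ((inv\<^bsub>Perm G\<^esub> f) (E k l)))"
        unfolding \<nu>_def using f \<mu>(1) by (simp add: Perm_mult_apply Perm_closed_apply)
      also have "\<dots> = E (u * (u' * k * e (w * v * b) + a)) (v * (v' * l + b))"
        by (simp add: i \<mu>(2) fE)
      also have "\<dots> = E (k * e (w * (v * b)) + u * a) (l + v * b)"
        using cong_add[OF cong_scalar_right[OF k, of "e (w * (v * b))"] cong_refl, of "u * a"]
          cong_add[OF l cong_refl, of "v * b"] by (intro E_cong) (simp_all add: algebra_simps)
      finally show ?thesis .
    qed
    then have "\<nu> \<in> H_fam w" using \<nu>P unfolding H_fam_def by blast
    moreover have "inv\<^bsub>Perm G\<^esub> f \<otimes>\<^bsub>Perm G\<^esub> \<nu> \<otimes>\<^bsub>Perm G\<^esub> f = \<mu>"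
    proof -
      have "inv\<^bsub>Perm G\<^esub> f \<otimes>\<^bsub>Perm G\<^esub> (f \<otimes>\<^bsub>Perm G\<^esub> \<mu>) = \<mu>"
        using f \<mu>(1) by (simp add: P.m_assoc[symmetric])
      then show ?thesis using f \<mu>(1) by (simp add: \<nu>_def P.m_assoc)
    qed
    ultimately show "\<mu> \<in> conj_by G f (H_fam w)" unfolding conj_by_def by blast
  qed
qed

text \<open>
  The shift \<open>a * e l\<close> of \<open>\<nu>\<close> is evaluated at \<open>v * l\<close> after \<open>f\<close> has been applied, which produces the
  index \<open>v\<close>. An inclusion suffices for the invariants below, since regularity of the conjugated
  subgroup supplies the elements they are tested on.
\<close>

lemma conj_by_Hopp:
  assumes f: "f \<in> carrier (Perm G)" and fE: "\<And>k l. f (E k l) = E (u * k) (v * l)"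
    and u: "[u * u' = 1] (mod int p)" and v: "[v * v' = 1] (mod int q)"
  shows "conj_by G f Hopp \<subseteq> Hopp_fam v"
proof (clarsimp simp: conj_by_def)
  fix \<nu> assume "\<nu> \<in> Hopp"
  then obtain a b where \<nu>: "\<nu> \<in> carrier (Perm G)" "\<And>k l. \<nu> (E k l) = E (k + a * e l) (l + b)"
    unfolding Hopp_def by blast
  have vb: "[v * (v' * b) = b] (mod int q)" using cong_scalar_right[OF v, of b] by (simp add: mult.assoc)
  have "(inv\<^bsub>Perm G\<^esub> f \<otimes>\<^bsub>Perm G\<^esub> \<nu> \<otimes>\<^bsub>Perm G\<^esub> f) (E k l) =
      E (k + u' * a * e (v * l)) (l + v' * b)" for k l
  proof (rule conj_apply[OF f \<nu>(1)])
    have "[u * (k + u' * a * e (v * l)) = u * k + a * e (v * l)] (mod int p)"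
      using cong_add[OF cong_refl cong_scalar_right[OF u, of "a * e (v * l)"], of "u * k"]
      by (simp add: algebra_simps)
    moreover have "[v * (l + v' * b) = v * l + b] (mod int q)"
      using cong_add[OF cong_refl vb, of "v * l"] by (simp add: algebra_simps)
    ultimately show "f (E (k + u' * a * e (v * l)) (l + v' * b)) = \<nu> (f (E k l))"
      unfolding fE \<nu>(2) by (rule E_cong)
  qed auto
  then show "inv\<^bsub>Perm G\<^esub> f \<otimes>\<^bsub>Perm G\<^esub> \<nu> \<otimes>\<^bsub>Perm G\<^esub> f \<in> Hopp_fam v"
    using conj_closed[OF f \<nu>(1)] unfolding Hopp_fam_def by blast
qed

text \<open>
  A permutation prescribed on the representatives \<open>0 \<le> k < p\<close>, \<open>0 \<le> l < q\<close> is known on all integer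
  coordinates once the prescription is invariant under congruence.
\<close>

lemma eq_on_E_from_nat:
  assumes "\<forall>k \<in> {0..p - 1}. \<forall>l \<in> {0..q - 1}. f (\<sigma> [^] k \<otimes> \<tau> [^] l) = F (int k) (int l)"
    and "\<And>k k' l l'. [k = k'] (mod int p) \<Longrightarrow> [l = l'] (mod int q) \<Longrightarrow> F k l = F k' l'"
  shows "f (E k l) = F k l"
  by (rule E_nat_cases[of k l]) (use assms in metis)

text \<open>
  Both generators lie in \<open>H\<close>, and a transitive subgroup of a group with trivial stabilizers is the
  whole group.
\<close>

lemma generate_eq_H:
  assumes \<eta>: "\<eta> \<in> carrier (Perm G)"
      "\<forall>k \<in> {0..p - 1}. \<forall>l \<in> {0..q - 1}. \<eta> (\<sigma> [^] k \<otimes> \<tau> [^] l) = \<sigma> [^] (k + 1) \<otimes> \<tau> [^] l"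
    and \<pi>: "\<pi> \<in> carrier (Perm G)"
      "\<forall>k \<in> {0..p - 1}. \<forall>l \<in> {0..q - 1}.
         \<pi> (\<sigma> [^] k \<otimes> \<tau> [^] l) = \<sigma> [^] (int k * g) \<otimes> \<tau> [^] (l + 1)"
  shows "generate (Perm G) {\<eta>, \<pi>} = H"
proof -
  interpret P: group "Perm G" by (rule group_BijGroup)
  have "\<eta> (E k l) = E (k * e 0 + 1) (l + 0)" for k l
    by (rule eq_on_E_from_nat[where F = "\<lambda>k l. E (k * e 0 + 1) (l + 0)"])
       (use \<eta>(2) E_nat[of "_ + 1"] in \<open>auto simp: add.commute intro!: E_cong cong_add\<close>)
  moreover have "\<pi> (E k l) = E (k * e 1 + 0) (l + 1)" for k l
  proof (rule eq_on_E_from_nat[where F = "\<lambda>k l. E (k * e 1 + 0) (l + 1)"])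
    have "E (int i * e 1 + 0) (int j + 1) = \<sigma> [^] (int i * g) \<otimes> \<tau> [^] (j + 1)" for i j :: nat
    proof -
      have "E (int i * e 1 + 0) (int j + 1) = E (int i * g) (int (j + 1))"
        by (rule E_cong) (use e_1 in \<open>auto simp: add.commute intro: cong_scalar_left\<close>)
      then show ?thesis by (simp only: E_def int_pow_int)
    qed
    then show "\<forall>k \<in> {0..p - 1}. \<forall>l \<in> {0..q - 1}.
        \<pi> (\<sigma> [^] k \<otimes> \<tau> [^] l) = E (int k * e 1 + 0) (int l + 1)" using \<pi>(2) by simp
  qed (auto intro!: E_cong cong_add cong_scalar_right)
  ultimately have "{\<eta>, \<pi>} \<subseteq> H" using \<eta>(1) \<pi>(1) unfolding H_def by blast
  then have XH: "generate (Perm G) {\<eta>, \<pi>} \<subseteq> H"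
    by (rule P.generate_subgroup_incl[OF _ subgroup_H])
  have reg: "regular_subgroup G (generate (Perm G) {\<eta>, \<pi>})" using regular_stable_H assms by blast
  have X: "subgroup (generate (Perm G) {\<eta>, \<pi>}) (Perm G)"
    using reg by (simp add: regular_subgroup_def)
  have tr: "\<exists>\<nu> \<in> generate (Perm G) {\<eta>, \<pi>}. \<nu> \<one> = x" if "x \<in> carrier G" for x
    using reg that one_closed unfolding regular_subgroup_def by blast
  have "generate (Perm G) {\<eta>, \<pi>} = H \<and> regular_subgroup G (generate (Perm G) {\<eta>, \<pi>})"
    using tr free_H by (intro regular_criterion[OF X subgroup_H XH]) blast+
  then show ?thesis by blast
qed

lemma generate_subset_Hopp:
  assumes \<eta>': "\<eta>' \<in> carrier (Perm G)"
      "\<forall>k \<in> {0..p - 1}. \<forall>l \<in> {0..q - 1}.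
         \<eta>' (\<sigma> [^] k \<otimes> \<tau> [^] l) = \<sigma> [^] (int k + g ^ l) \<otimes> \<tau> [^] l"
    and \<pi>': "\<pi>' \<in> carrier (Perm G)"
      "\<forall>k \<in> {0..p - 1}. \<forall>l \<in> {0..q - 1}. \<pi>' (\<sigma> [^] k \<otimes> \<tau> [^] l) = \<sigma> [^] k \<otimes> \<tau> [^] (l + 1)"
  shows "generate (Perm G) {\<eta>', \<pi>'} \<subseteq> Hopp"
proof -
  interpret P: group "Perm G" by (rule group_BijGroup)
  have "\<eta>' (E k l) = E (k + 1 * e l) (l + 0)" for k l
  proof (rule eq_on_E_from_nat[where F = "\<lambda>k l. E (k + 1 * e l) (l + 0)"])
    have "E (int i + 1 * e (int j)) (int j + 0) = \<sigma> [^] (int i + g ^ j) \<otimes> \<tau> [^] j" for i j :: nat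
    proof -
      have "E (int i + 1 * e (int j)) (int j + 0) = E (int i + g ^ j) (int j)"
        by (rule E_cong) (use e_nat in \<open>auto intro: cong_add\<close>)
      then show ?thesis by (simp only: E_def int_pow_int)
    qed
    then show "\<forall>k \<in> {0..p - 1}. \<forall>l \<in> {0..q - 1}.
        \<eta>' (\<sigma> [^] k \<otimes> \<tau> [^] l) = E (int k + 1 * e (int l)) (int l + 0)" using \<eta>'(2) by simp
  next
    fix k k' l l' :: int assume "[k = k'] (mod int p)" "[l = l'] (mod int q)"
    then show "E (k + 1 * e l) (l + 0) = E (k' + 1 * e l') (l' + 0)"
      using e_cong[of l l'] by (auto intro!: E_cong cong_add)
  qed
  moreover have "\<pi>' (E k l) = E (k + 0 * e l) (l + 1)" for k l
    by (rule eq_on_E_from_nat[where F = "\<lambda>k l. E (k + 0 * e l) (l + 1)"])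
       (use \<pi>'(2) E_nat[of _ "_ + 1"] in \<open>auto simp: add.commute intro!: E_cong cong_add\<close>)
  ultimately have "{\<eta>', \<pi>'} \<subseteq> Hopp" using \<eta>'(1) \<pi>'(1) unfolding Hopp_def by blast
  then show ?thesis by (rule P.generate_subgroup_incl[OF _ subgroup_Hopp])
qed

section \<open>The action of G\<close>

lemma perm_act_H_fam:
  assumes \<nu>: "\<nu> \<in> carrier (Perm G)" "\<And>k l. \<nu> (E k l) = E (k * e (v * b) + a) (l + b)"
  shows "perm_act G (E m n) \<nu> (E k l) = E (k * e (v * b) + (m - m * e (v * b) + a)) (l + b)"
  using perm_act_apply[OF _ \<nu>(1), of "E m n" "E k l"]
  by (simp add: E_inv E_mult \<nu>(2) algebra_simps)

text \<open>
  The exponent \<open>n\<close> of \<open>\<tau>\<close> does not occur in the formula for the action: it is subtracted before and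
  added after applying \<open>\<nu>\<close>, and \<open>\<nu>\<close> is a mere translation in the second coordinate.
\<close>

lemma \<tau>_trivial_on_H_fam:
  assumes "\<nu> \<in> H_fam v"
  shows "perm_act G (E m n) \<nu> = perm_act G (E m n') \<nu>"
proof -
  obtain a b where \<nu>: "\<nu> \<in> carrier (Perm G)" "\<And>k l. \<nu> (E k l) = E (k * e (v * b) + a) (l + b)"
    using assms unfolding H_fam_def by blast
  show ?thesis
    by (intro Perm_eqI_E perm_act_closed) (simp_all add: \<nu>(1) perm_act_H_fam[OF \<nu>])
qed

text \<open>
  An element with \<open>\<nu> \<one> = \<tau>\<close> has \<open>b = 1\<close>, and \<open>\<sigma>\<close> shifts its parameter \<open>a\<close> by \<open>1 - e v\<close>. This is not
  zero modulo \<open>p\<close>, since \<open>g\<close> has order \<open>q\<close> and \<open>v\<close> is prime to \<open>q\<close>.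
\<close>

lemma \<sigma>_nontrivial_on_H_fam:
  assumes "\<nu> \<in> H_fam v" and "\<nu> \<one> = E 0 1" and v: "\<not> [v = 0] (mod int q)"
  shows "perm_act G (E 1 0) \<nu> \<noteq> \<nu>"
proof
  assume fixed: "perm_act G (E 1 0) \<nu> = \<nu>"
  obtain a b where \<nu>: "\<nu> \<in> carrier (Perm G)" "\<And>k l. \<nu> (E k l) = E (k * e (v * b) + a) (l + b)"
    using assms(1) unfolding H_fam_def by blast
  have b: "[b = 1] (mod int q)" using assms(2) \<nu>(2)[of 0 0] by (simp add: E_eq_iff cong_sym_eq)
  have "E (1 - e (v * b) + a) b = E a b"
    using perm_act_H_fam[OF \<nu>, of 1 0 0 0] fixed \<nu>(2)[of 0 0] by simp
  then have "[e (v * b) = 1] (mod int p)"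
    by (simp add: E_eq_iff cong_iff_dvd_diff dvd_diff_commute)
  moreover have "e (v * b) = e v" using cong_scalar_left[OF b, of v] by (intro e_cong) simp
  ultimately have "[g ^ nat (v mod int q) = 1] (mod int p)" unfolding e_def[symmetric] by simp
  then have "q dvd nat (v mod int q)" by (simp only: g_pow_cong)
  then have "int q dvd v mod int q" using q0 by (metis int_dvd_int_iff int_nat_eq of_nat_0_less_iff pos_mod_sign)
  then show False using v by (simp add: cong_0_iff dvd_mod_iff)
qed

lemma pow_Hopp_fam_exponent:
  assumes \<nu>: "\<nu> \<in> carrier (Perm G)" "\<And>k l. \<nu> (E k l) = E (k + a * e (v * l)) (l + b)"
  shows "\<exists>c. (\<nu> [^]\<^bsub>Perm G\<^esub> n) (E k l) = E c (l + int n * b)"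
proof (induction n arbitrary: k l)
  interpret P: group "Perm G" by (rule group_BijGroup)
  case (Suc n)
  have "(\<nu> [^]\<^bsub>Perm G\<^esub> Suc n) (E k l) = (\<nu> [^]\<^bsub>Perm G\<^esub> n) (E (k + a * e (v * l)) (l + b))"
    using Perm_mult_apply[of "\<nu> [^]\<^bsub>Perm G\<^esub> n" G \<nu> "E k l"] \<nu> by simp
  then show ?case using Suc.IH[of "k + a * e (v * l)" "l + b"] by (simp add: algebra_simps)
qed (auto simp: Perm_one_apply)

lemma pow_Hopp_fam:
  assumes \<nu>: "\<nu> \<in> carrier (Perm G)" "\<And>k l. \<nu> (E k l) = E (k + a * e (v * l)) l"
  shows "(\<nu> [^]\<^bsub>Perm G\<^esub> n) (E k l) = E (k + int n * a * e (v * l)) l"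
proof (induction n arbitrary: k l)
  interpret P: group "Perm G" by (rule group_BijGroup)
  case (Suc n)
  have "(\<nu> [^]\<^bsub>Perm G\<^esub> Suc n) (E k l) = (\<nu> [^]\<^bsub>Perm G\<^esub> n) (E (k + a * e (v * l)) l)"
    using Perm_mult_apply[of "\<nu> [^]\<^bsub>Perm G\<^esub> n" G \<nu> "E k l"] \<nu> by simp
  then show ?case using Suc.IH[of "k + a * e (v * l)" l] by (simp add: algebra_simps)
qed (auto simp: Perm_one_apply)

lemma \<sigma>_trivial_on_Hopp_fam:
  assumes "\<nu> \<in> Hopp_fam v"
  shows "perm_act G (E 1 0) \<nu> = \<nu>"
proof -
  obtain a b where \<nu>: "\<nu> \<in> carrier (Perm G)" "\<And>k l. \<nu> (E k l) = E (k + a * e (v * l)) (l + b)"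
    using assms unfolding Hopp_fam_def by blast
  have "perm_act G (E 1 0) \<nu> (E k l) = \<nu> (E k l)" for k l
    using perm_act_apply[OF E_closed[of 1 0] \<nu>(1), of "E k l"] by (simp add: E_inv E_mult \<nu>(2))
  then show ?thesis by (intro Perm_eqI_E perm_act_closed \<nu>(1) E_closed)
qed

text \<open>
  The \<open>p\<close>-th power of \<open>\<nu>\<close> translates the second coordinate by \<open>p * b\<close>, and \<open>p\<close> is invertible modulo
  \<open>q\<close>; so elements killed by \<open>p\<close> have \<open>b = 0\<close>.
\<close>

lemma Hopp_fam_exponent_p:
  assumes "\<nu> \<in> Hopp_fam v" and pow: "\<nu> [^]\<^bsub>Perm G\<^esub> p = \<one>\<^bsub>Perm G\<^esub>"
  obtains a where "\<nu> \<in> carrier (Perm G)" "\<And>k l. \<nu> (E k l) = E (k + a * e (v * l)) l"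
proof -
  obtain a b where \<nu>: "\<nu> \<in> carrier (Perm G)" "\<And>k l. \<nu> (E k l) = E (k + a * e (v * l)) (l + b)"
    using assms(1) unfolding Hopp_fam_def by blast
  obtain c where "E 0 0 = E c (0 + int p * b)"
    using pow_Hopp_fam_exponent[OF \<nu>, of p 0 0] unfolding pow by (auto simp: Perm_one_apply)
  then have "[0 = int p * b] (mod int q)" unfolding E_eq_iff by simp
  then have b: "[b = 0] (mod int q)"
    using coprime_pq by (simp add: cong_0_iff cong_sym_eq[of 0] coprime_dvd_mult_right_iff coprime_commute)
  have "\<nu> (E k l) = E (k + a * e (v * l)) l" for k l
    unfolding \<nu>(2) by (rule E_cong) (use cong_add[OF cong_refl b, of l] in auto)
  then show ?thesis using that \<nu>(1) by blast
qed

lemma g_pow_nat: "[int (nat (g mod int p) ^ n) = g ^ n] (mod int p)"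
  using p0 by (simp add: cong_def power_mod)

text \<open>
  Acting by \<open>\<tau>\<inverse>\<close> replaces the shift \<open>a * e (t * l)\<close> by \<open>a * e (t * (l + 1))\<close>, that is, multiplies
  \<open>a\<close> by \<open>g^t\<close>. On elements with \<open>b = 0\<close> this is the same as taking a power. The natural number
  \<open>g mod p\<close> stands in for \<open>g\<close> so that the exponent is not negative.
\<close>

lemma \<tau>_inv_power_on_Hopp_fam:
  assumes "\<nu> \<in> Hopp_fam (int t)" and pow: "\<nu> [^]\<^bsub>Perm G\<^esub> p = \<one>\<^bsub>Perm G\<^esub>"
  shows "perm_act G (E 0 (- 1)) \<nu> = \<nu> [^]\<^bsub>Perm G\<^esub> (nat (g mod int p) ^ t)"
proof -
  interpret P: group "Perm G" by (rule group_BijGroup)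
  obtain a where \<nu>: "\<nu> \<in> carrier (Perm G)" "\<And>k l. \<nu> (E k l) = E (k + a * e (int t * l)) l"
    using Hopp_fam_exponent_p[OF assms] by blast
  let ?m = "nat (g mod int p) ^ t"
  have "perm_act G (E 0 (- 1)) \<nu> (E k l) = (\<nu> [^]\<^bsub>Perm G\<^esub> ?m) (E k l)" for k l
  proof -
    have "perm_act G (E 0 (- 1)) \<nu> (E k l) = E (k + a * e (int t + int t * l)) l"
      using perm_act_apply[OF E_closed[of 0 "- 1"] \<nu>(1), of "E k l"]
      by (simp add: E_inv E_mult \<nu>(2) algebra_simps)
    also have "\<dots> = E (k + int ?m * a * e (int t * l)) l"
    proof (intro E_cong cong_refl cong_add)
      have "[e (int t + int t * l) = e (int t) * e (int t * l)] (mod int p)" by (rule e_add)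
      moreover have "[e (int t) * e (int t * l) = int ?m * e (int t * l)] (mod int p)"
        by (rule cong_scalar_right) (use e_nat g_pow_nat cong_sym cong_trans in blast)
      ultimately have "[a * e (int t + int t * l) = a * (int ?m * e (int t * l))] (mod int p)"
        by (metis cong_scalar_left cong_trans)
      then show "[a * e (int t + int t * l) = int ?m * a * e (int t * l)] (mod int p)"
        by (simp only: ac_simps)
    qed
    also have "\<dots> = (\<nu> [^]\<^bsub>Perm G\<^esub> ?m) (E k l)" using pow_Hopp_fam[OF \<nu>] by simp
    finally show ?thesis .
  qed
  then show ?thesis by (intro Perm_eqI_E perm_act_closed) (simp_all add: \<nu>(1))
qed

text \<open>
  The element sending \<open>\<one>\<close> to \<open>\<sigma>\<close> has \<open>a = 1\<close> and \<open>b = 0\<close>, so its \<open>m\<close>-th power sends \<open>\<one>\<close> to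
  \<open>\<sigma>^m\<close>. It is the test element that recovers the exponent of the power action modulo \<open>p\<close>.
\<close>

lemma Hopp_fam_element_of_order_p:
  assumes "\<nu> \<in> Hopp_fam v" and "\<nu> \<one> = E 1 0"
  shows "\<nu> [^]\<^bsub>Perm G\<^esub> p = \<one>\<^bsub>Perm G\<^esub>"
    and "\<nu> [^]\<^bsub>Perm G\<^esub> (m :: nat) = \<nu> [^]\<^bsub>Perm G\<^esub> (n :: nat) \<Longrightarrow> [m = n] (mod p)"
proof -
  interpret P: group "Perm G" by (rule group_BijGroup)
  obtain a b where \<nu>: "\<nu> \<in> carrier (Perm G)" "\<And>k l. \<nu> (E k l) = E (k + a * e (v * l)) (l + b)"
    using assms(1) unfolding Hopp_fam_def by blast
  have a: "[a = 1] (mod int p)" and b: "[b = 0] (mod int q)"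
    using assms(2) \<nu>(2)[of 0 0] by (simp_all add: E_eq_iff cong_sym_eq)
  have \<nu>': "\<nu> (E k l) = E (k + 1 * e (v * l)) l" for k l
    unfolding \<nu>(2)
    using cong_add[OF cong_refl b, of l] cong_add[OF cong_refl cong_scalar_right[OF a], of k]
    by (intro E_cong) simp_all
  show "\<nu> [^]\<^bsub>Perm G\<^esub> p = \<one>\<^bsub>Perm G\<^esub>"
    by (rule Perm_oneI)
       (simp_all add: \<nu>(1) pow_Hopp_fam[OF \<nu>(1) \<nu>'] E_eq_iff cong_iff_dvd_diff)
  assume "\<nu> [^]\<^bsub>Perm G\<^esub> m = \<nu> [^]\<^bsub>Perm G\<^esub> n"
  then have "E (int m) 0 = E (int n) 0"
    using pow_Hopp_fam[OF \<nu>(1) \<nu>', of m 0 0] pow_Hopp_fam[OF \<nu>(1) \<nu>', of n 0 0] by simp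
  then show "[m = n] (mod p)" by (simp add: E_eq_iff cong_int_iff)
qed

section \<open>Isomorphisms and non-isomorphisms\<close>

lemma ex_inverse:
  assumes "prime (n :: nat)" "\<not> [v = 0] (mod int n)"
  obtains v' where "[v * v' = 1] (mod int n)"
proof -
  have "coprime v (int n)"
    using assms by (metis cong_0_iff coprime_commute prime_imp_coprime prime_int_nat_transfer prime_nat_int_transfer)
  then show ?thesis using that cong_solve_coprime_int by blast
qed

text \<open>
  The automorphism is a power map \<open>x \<mapsto> x^m\<close>, a homomorphism because \<open>G\<close> is abelian, with \<open>m\<close>
  congruent to \<open>1\<close> modulo \<open>p\<close> and to \<open>r\<close> modulo \<open>q\<close>. Its inverse is built in the same way from \<open>r'\<close>.
  The factor \<open>1\<close> in the conclusion keeps the form required of a map that scales both coordinates.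
\<close>

lemma ex_auto_fixing_\<sigma>:
  assumes r: "[r * r' = 1] (mod int q)"
  obtains w where "w \<in> auto G" "\<And>k l. w (E k l) = E (1 * k) (r * l)"
proof -
  have "\<exists>m. [m = 1] (mod int p) \<and> [m = s] (mod int q)" for s
    by (rule binary_chinese_remainder_int[OF coprime_pq])
  then obtain m m' where m: "[m = 1] (mod int p)" "[m = r] (mod int q)"
    and m': "[m' = 1] (mod int p)" "[m' = r'] (mod int q)" by metis
  define w where "w n = (\<lambda>x \<in> carrier G. x [^] (n :: int))" for n
  have hom: "w n \<in> hom G G" for n
    by (auto simp: w_def hom_def int_pow_distrib)
  have wE: "w n (E k l) = E (n * k) (n * l)" for n k l
    using hom_E[OF hom, of n n n] \<sigma>(1) \<tau>(1) by (simp add: w_def)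
  have mm: "[m * m' = 1] (mod int p)" "[m * m' = 1] (mod int q)"
    using cong_mult[OF m(1) m'(1)] cong_mult[OF m(2) m'(2)] r by (auto intro: cong_trans)
  have inv: "w m (w m' x) = x \<and> w m' (w m x) = x" if "x \<in> carrier G" for x
  proof -
    obtain k l where x: "x = E k l" using \<open>x \<in> carrier G\<close> by (rule E_cases)
    have "E (m * m' * k) (m * m' * l) = E (1 * k) (1 * l)"
      by (intro E_cong cong_scalar_right mm)
    then show ?thesis by (simp add: x wE ac_simps)
  qed
  have "bij_betw (w m) (carrier G) (carrier G)"
    by (rule bij_betwI[where g = "w m'"]) (use inv in \<open>auto simp: w_def\<close>)
  then have "w m \<in> auto G" using hom by (auto simp: auto_def Bij_def w_def)
  moreover have "w m (E k l) = E (1 * k) (r * l)" for k l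
    unfolding wE by (intro E_cong cong_scalar_right m)
  ultimately show ?thesis using that by blast
qed

text \<open>
  The isomorphism is conjugation by the automorphism that fixes \<open>\<sigma>\<close> and raises \<open>\<tau>\<close> to the power
  \<open>t / s\<close>. The maps defining the two subgroups scale \<open>\<sigma>\<close> as well, and conjugation by their quotient
  would not respect the action; leaving \<open>\<sigma>\<close> alone is what makes it equivariant.
\<close>

lemma G_isomorphic_H_fam:
  assumes s: "\<not> [s = 0] (mod int q)" and t: "\<not> [t = 0] (mod int q)"
    and sub: "subgroup (H_fam s) (Perm G)"
  shows "G_isomorphic G (H_fam s) (H_fam t)"
proof -
  obtain s' t' where s': "[s * s' = 1] (mod int q)" and t': "[t * t' = 1] (mod int q)"
    using ex_inverse[OF prime_q s] ex_inverse[OF prime_q t] by metis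
  have inv: "[s' * t * (s * t') = 1] (mod int q)" using cong_mult[OF s' t'] by (simp add: ac_simps)
  obtain w where w: "w \<in> auto G" "\<And>k l. w (E k l) = E (1 * k) (s' * t * l)"
    using ex_auto_fixing_\<sigma>[OF inv] by blast
  have wP: "w \<in> carrier (Perm G)" using w(1) by (auto simp: auto_def BijGroup_def)
  have "perm_act G (w x) \<nu> = perm_act G x \<nu>" if "x \<in> carrier G" "\<nu> \<in> H_fam s" for x \<nu>
    using that(1) \<tau>_trivial_on_H_fam[OF that(2)] by (elim E_cases) (simp add: w(2))
  then have "G_isomorphic G (H_fam s) (conj_by G w (H_fam s))"
    by (intro G_isomorphic_conj_by w sub)
  also have "conj_by G w (H_fam s) = H_fam (s * (s' * t))"
    by (rule conj_by_H_fam[OF wP w(2) _ inv, of 1]) simp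
  also have "\<dots> = H_fam t"
    using cong_scalar_right[OF s', of t] by (intro H_fam_cong) (simp add: ac_simps)
  finally show ?thesis .
qed

text \<open>
  The test element of \<open>M\<close> that sends \<open>\<one>\<close> to \<open>\<sigma>\<close> is raised by \<open>\<tau>\<inverse>\<close> to the power \<open>g^t\<close>, and, by
  transport of the invariant from \<open>N\<close>, also to the power \<open>g^s\<close>.
\<close>

lemma G_isomorphic_Hopp_fam_imp_cong:
  assumes iso: "G_isomorphic G N M"
    and N: "subgroup N (Perm G)" "N \<subseteq> Hopp_fam (int s)"
    and M: "regular_subgroup G M" "M \<subseteq> Hopp_fam (int t)"
  shows "[s = t] (mod q)"
proof -
  let ?h = "nat (g mod int p)"
  have subM: "subgroup M (Perm G)" using M by (simp add: regular_subgroup_def)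
  obtain \<mu> where \<mu>: "\<mu> \<in> M" "\<mu> \<one> = E 1 0"
    using M(1) E_closed one_closed unfolding regular_subgroup_def by blast
  have \<mu>': "\<mu> \<in> Hopp_fam (int t)" using \<mu> M by blast
  note pow = Hopp_fam_element_of_order_p(1)[OF \<mu>' \<mu>(2)]
  have "perm_act G (E 0 (- 1)) \<mu> = \<mu> [^]\<^bsub>Perm G\<^esub> (?h ^ s)"
    by (rule G_isomorphic_power_act[OF iso N(1) subM _ _ \<mu>(1) pow])
       (use N(2) \<tau>_inv_power_on_Hopp_fam in auto)
  then have "\<mu> [^]\<^bsub>Perm G\<^esub> (?h ^ s) = \<mu> [^]\<^bsub>Perm G\<^esub> (?h ^ t)"
    using \<tau>_inv_power_on_Hopp_fam[OF \<mu>' pow] by simp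
  then have "[?h ^ s = ?h ^ t] (mod p)" by (rule Hopp_fam_element_of_order_p(2)[OF \<mu>' \<mu>(2)])
  moreover have "coprime p ?h" using ord_g q0 by (auto simp: Pocklington.ord_def split: if_splits)
  ultimately show ?thesis using ord_g by (simp add: order_divides_expdiff)
qed

lemma Hopp_fam_not_G_isomorphic_H_fam:
  assumes N: "subgroup N (Perm G)" "N \<subseteq> Hopp_fam s"
    and M: "regular_subgroup G M" "M \<subseteq> H_fam t" and t: "\<not> [t = 0] (mod int q)"
  shows "\<not> G_isomorphic G N M"
proof
  assume iso: "G_isomorphic G N M"
  interpret P: group "Perm G" by (rule group_BijGroup)
  have subM: "subgroup M (Perm G)" using M by (simp add: regular_subgroup_def)
  obtain \<mu> where \<mu>: "\<mu> \<in> M" "\<mu> \<one> = E 0 1"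
    using M(1) E_closed one_closed unfolding regular_subgroup_def by blast
  have "perm_act G (E 1 0) \<mu> = \<mu> [^]\<^bsub>Perm G\<^esub> (1 :: nat)"
    by (rule G_isomorphic_power_act[OF iso N(1) subM E_closed _ \<mu>(1), of 0])
       (use N(2) \<sigma>_trivial_on_Hopp_fam subgroup.subset[OF N(1)] in \<open>auto simp: subset_eq\<close>)
  then have "perm_act G (E 1 0) \<mu> = \<mu>" using \<mu>(1) subgroup.subset[OF subM] by (auto simp: subset_eq)
  moreover have "\<mu> \<in> H_fam t" using \<mu>(1) M(2) by blast
  ultimately show False using \<sigma>_nontrivial_on_H_fam \<mu>(2) t by blast
qed

end

theorem proposition8p1:
  fixes G :: "('a, 'b) monoid_scheme"
    and p q :: nat and g :: int
    and \<sigma> \<tau> :: 'a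
    and \<eta> \<pi> \<eta>' \<pi>' :: "'a \<Rightarrow> 'a"
    and \<phi> :: "nat \<Rightarrow> 'a \<Rightarrow> 'a"
  assumes "prime p" and "prime q" and "p > q" and "[p = 1] (mod q)"
    and "ord p (nat (g mod int p)) = q"
    and "group G" and "cyclic_group G" and "order G = p * q"
    and "\<sigma> \<in> carrier G" and "group.ord G \<sigma> = p"
    and "\<tau> \<in> carrier G" and "group.ord G \<tau> = q"
    and "\<tau> \<otimes>\<^bsub>G\<^esub> \<sigma> \<otimes>\<^bsub>G\<^esub> inv\<^bsub>G\<^esub> \<tau> = \<sigma>"
    and "carrier G = {\<sigma> [^]\<^bsub>G\<^esub> i \<otimes>\<^bsub>G\<^esub> \<tau> [^]\<^bsub>G\<^esub> j | (i :: nat) (j :: nat). i \<le> p - 1 \<and> j \<le> q - 1}"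
    and "\<eta> \<in> carrier (Perm G)"
    and "\<forall>k \<in> {0..p - 1}. \<forall>l \<in> {0..q - 1}.
           \<eta> (\<sigma> [^]\<^bsub>G\<^esub> k \<otimes>\<^bsub>G\<^esub> \<tau> [^]\<^bsub>G\<^esub> l) = \<sigma> [^]\<^bsub>G\<^esub> (k + 1) \<otimes>\<^bsub>G\<^esub> \<tau> [^]\<^bsub>G\<^esub> l"
    and "\<pi> \<in> carrier (Perm G)"
    and "\<forall>k \<in> {0..p - 1}. \<forall>l \<in> {0..q - 1}.
           \<pi> (\<sigma> [^]\<^bsub>G\<^esub> k \<otimes>\<^bsub>G\<^esub> \<tau> [^]\<^bsub>G\<^esub> l) = \<sigma> [^]\<^bsub>G\<^esub> (int k * g) \<otimes>\<^bsub>G\<^esub> \<tau> [^]\<^bsub>G\<^esub> (l + 1)"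
    and "\<eta>' \<in> carrier (Perm G)"
    and "\<forall>k \<in> {0..p - 1}. \<forall>l \<in> {0..q - 1}.
           \<eta>' (\<sigma> [^]\<^bsub>G\<^esub> k \<otimes>\<^bsub>G\<^esub> \<tau> [^]\<^bsub>G\<^esub> l) = \<sigma> [^]\<^bsub>G\<^esub> (int k + g ^ l) \<otimes>\<^bsub>G\<^esub> \<tau> [^]\<^bsub>G\<^esub> l"
    and "\<pi>' \<in> carrier (Perm G)"
    and "\<forall>k \<in> {0..p - 1}. \<forall>l \<in> {0..q - 1}.
           \<pi>' (\<sigma> [^]\<^bsub>G\<^esub> k \<otimes>\<^bsub>G\<^esub> \<tau> [^]\<^bsub>G\<^esub> l) = \<sigma> [^]\<^bsub>G\<^esub> k \<otimes>\<^bsub>G\<^esub> \<tau> [^]\<^bsub>G\<^esub> (l + 1)"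
    and "\<forall>t \<in> {1..q - 1}. \<phi> t \<in> auto G \<and> \<phi> t \<sigma> = \<sigma> [^]\<^bsub>G\<^esub> t \<and> \<phi> t \<tau> = \<tau> [^]\<^bsub>G\<^esub> t"
  shows "let N = generate (Perm G) {\<eta>, \<pi>};
             Nopp = generate (Perm G) {\<eta>', \<pi>'};
             Nt = (\<lambda>t. conj_by G (\<phi> t) N);
             Nopp_t = (\<lambda>t. conj_by G (\<phi> t) Nopp)
         in (\<forall>s \<in> {1..q - 1}. \<forall>t \<in> {1..q - 1}. G_isomorphic G (Nt s) (Nt t)) \<and>
            (\<forall>s \<in> {1..q - 1}. \<forall>t \<in> {1..q - 1}. s \<noteq> t \<longrightarrow> \<not> G_isomorphic G (Nopp_t s) (Nopp_t t)) \<and>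
            (\<forall>s \<in> {1..q - 1}. \<forall>t \<in> {1..q - 1}. \<not> G_isomorphic G (Nopp_t s) (Nt t))"
proof -
  have "comm_group G" using group.cyclic_imp_abelian_group assms by blast
  then interpret cyclic_pq G p q g \<sigma> \<tau>
    using assms by (intro cyclic_pq.intro cyclic_pq_axioms.intro)
  define N where "N = generate (Perm G) {\<eta>, \<pi>}"
  define Nopp where "Nopp = generate (Perm G) {\<eta>', \<pi>'}"
  define Nt where "Nt t = conj_by G (\<phi> t) N" for t
  define Nopp_t where "Nopp_t t = conj_by G (\<phi> t) Nopp" for t
  have NH: "N = H" unfolding N_def using generate_eq_H assms by blast
  have NoppH: "Nopp \<subseteq> Hopp" unfolding Nopp_def using generate_subset_Hopp assms by blast
  have unit: "\<not> [int t = 0] (mod int n)" if "t \<in> {1..q - 1}" "n = p \<or> n = q" for t n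
  proof -
    have "0 < t" "t < n" using that q_less_p q0 by auto
    then show ?thesis by (simp add: cong_0_iff nat_dvd_not_less)
  qed
  have reg: "regular_subgroup G (Nt t)" "regular_subgroup G (Nopp_t t)" if "t \<in> {1..q - 1}" for t
  proof -
    have "\<phi> t \<in> auto G" using assms that by blast
    moreover have "regular_subgroup G N \<and> G_stable G N"
      unfolding N_def using regular_stable_H assms by blast
    moreover have "regular_subgroup G Nopp \<and> G_stable G Nopp"
      unfolding Nopp_def using regular_stable_Hopp assms by blast
    ultimately show "regular_subgroup G (Nt t)" "regular_subgroup G (Nopp_t t)"
      unfolding Nt_def Nopp_t_def using conj_by_regular_stable by blast+
  qed
  have fam: "Nt t = H_fam (int t)" "Nopp_t t \<subseteq> Hopp_fam (int t)" if t: "t \<in> {1..q - 1}" for t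
  proof -
    have \<phi>: "\<phi> t \<in> auto G" "\<phi> t \<sigma> = \<sigma> [^]\<^bsub>G\<^esub> int t" "\<phi> t \<tau> = \<tau> [^]\<^bsub>G\<^esub> int t"
      using assms t by (auto simp: int_pow_int)
    then have \<phi>P: "\<phi> t \<in> carrier (Perm G)" and hom: "\<phi> t \<in> hom G G"
      by (auto simp: auto_def BijGroup_def)
    obtain u where u: "[int t * u = 1] (mod int p)" using ex_inverse[OF prime_p unit] t by blast
    obtain v where v: "[int t * v = 1] (mod int q)" using ex_inverse[OF prime_q unit] t by blast
    note \<phi>E = hom_E[OF hom \<phi>(2,3)]
    show "Nt t = H_fam (int t)"
      using conj_by_H_fam[OF \<phi>P \<phi>E u v, of 1] by (simp add: Nt_def NH H_fam_1)
    have "Nopp_t t \<subseteq> conj_by G (\<phi> t) Hopp"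
      unfolding Nopp_t_def conj_by_def using NoppH by blast
    then show "Nopp_t t \<subseteq> Hopp_fam (int t)" using conj_by_Hopp[OF \<phi>P \<phi>E u v] by blast
  qed
  have sub: "subgroup (Nt t) (Perm G)" "subgroup (Nopp_t t) (Perm G)" if "t \<in> {1..q - 1}" for t
    using reg[OF that] by (simp_all add: regular_subgroup_def)
  have "G_isomorphic G (Nt s) (Nt t)" if "s \<in> {1..q - 1}" "t \<in> {1..q - 1}" for s t
    using G_isomorphic_H_fam[of "int s" "int t"] unit sub(1) fam(1) that by metis
  moreover have "\<not> G_isomorphic G (Nopp_t s) (Nopp_t t)"
    if st: "s \<in> {1..q - 1}" "t \<in> {1..q - 1}" "s \<noteq> t" for s t
  proof
    assume "G_isomorphic G (Nopp_t s) (Nopp_t t)"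
    then have "[s = t] (mod q)"
      using G_isomorphic_Hopp_fam_imp_cong[OF _ sub(2) fam(2) reg(2) fam(2)] st by blast
    moreover have "s < q" "t < q" using st q0 by auto
    ultimately show False using st(3) by (simp add: cong_def)
  qed
  moreover have "\<not> G_isomorphic G (Nopp_t s) (Nt t)"
    if st: "s \<in> {1..q - 1}" "t \<in> {1..q - 1}" for s t
    using Hopp_fam_not_G_isomorphic_H_fam[OF sub(2) fam(2) reg(1) equalityD1[OF fam(1)]]
      unit st by blast
  ultimately show ?thesis
    unfolding Let_def N_def[symmetric] Nopp_def[symmetric] Nt_def[symmetric] Nopp_t_def[symmetric]
    by blast
qed

end
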